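(* Let $n\ge 3$, $k\ge 4$ and $s\ge 2$ be integers, and let $G$ be a 2-connected simple graph on $n$ vertices. If $N_s(G)>g_s(n,k)$, then every edge of $G$ is contained in a cycle of $G$ of length at least $k$.
   Context: All graphs are finite and simple. $N_s(G)$ denotes the total number of $s$-cliques of $G$, i.e. of complete subgraphs of $G$ with exactly $s$ vertices (so $N_2(G)$ is the number of edges). The binomial coefficient $\binom{m}{j}$ is $0$ when $0\le m<j$. For integers $n\ge 3$, $k\ge 4$, $s\ge 2$, write $n-2=r(k-3)+t$ with integers $r\ge 0$ and $0\le t\le k-4$ (division with remainder), and define \[g_s(n,k)=\begin{cases} r\binom{k-1}{s}+\binom{t+2}{s} & \text{if } s\ge 3,\\[4pt] r\binom{k-3}{2}+\binom{t}{2}+2(n-2)+1 & \text{if } s=2.\end{cases}\] *)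

theory Defs
  imports "Graph_Theory.Graph_Theory"
begin

text \<open>
  A finite simple graph is a \<^locale>\<open>pair_graph\<close>: a finite vertex set together with a symmetric,
  irreflexive set of arcs. An undirected edge is thus a pair of opposite arcs.
\<close>

text \<open>
  Counted by vertex sets, so that every clique is counted once, regardless of the two arcs per edge.
  The constant \<^const>\<open>complete_digraph\<close> includes the requirement that there are exactly s vertices.
\<close>
definition num_cliques :: "nat \<Rightarrow> 'a pair_pre_digraph \<Rightarrow> nat" where
  "num_cliques s G =
     card {C. C \<subseteq> pverts G \<and> complete_digraph s (induce_subgraph (with_proj G) C)}"

definition vertex_connected :: "nat \<Rightarrow> 'a pair_pre_digraph \<Rightarrow> bool" where
  "vertex_connected l G \<longleftrightarrow>
     l < card (pverts G) \<and>
     (\<forall>X. X \<subseteq> pverts G \<and> card X < l \<longrightarrow>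
        connected (induce_subgraph (with_proj G) (pverts G - X)))"

text \<open>
  A cycle is given by the list of its arcs in one of its two directions. In a symmetric digraph,
  \<^const>\<open>pre_digraph.cycle\<close> also holds for the closed walk that runs along an edge and back;
  the bound 3 excludes it.
\<close>
definition undirected_cycle :: "'a pair_pre_digraph \<Rightarrow> ('a \<times> 'a) list \<Rightarrow> bool" where
  "undirected_cycle G p \<longleftrightarrow> pre_digraph.cycle (with_proj G) p \<and> 3 \<le> length p"

text \<open>The subtractions do not truncate for n at least 3 and k at least 4.\<close>
definition g_bound :: "nat \<Rightarrow> nat \<Rightarrow> nat \<Rightarrow> nat" where
  "g_bound s n k =
     (let r = (n - 2) div (k - 3); t = (n - 2) mod (k - 3) in
      if s = 2 then r * ((k - 3) choose 2) + (t choose 2) + 2 * (n - 2) + 1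
      else r * ((k - 1) choose s) + ((t + 2) choose s))"

end

theory Submission
  imports Defs
begin

text \<open>
  A cycle of length at least k through an edge uv is the same as a path from u to v on at least k
  vertices, so the claim is that a 2-connected graph without such a path has at most g_s(n,k)
  cliques of order s. With m = k - 3, the bound equals C(2,s) + \<Sum>i<n-2. w(i mod m), where
  w(i) = C(i+2, s-1) is the number of s-cliques gained by a new vertex that is joined to u, v and i
  further pairwise adjacent vertices: the n - 2 vertices other than u and v are distributed over
  cliques of order m, with the rest in one smaller clique. As w is monotone, this block sum is
  superadditive in n - 2.

  The proof is by induction on n. Among the counterexamples on a given vertex set, choose one that
  maximizes a potential, namely the number of edges plus weighted degrees of u, of v and of an
  arbitrary third vertex a.

  \<^item> If u and a neighbour w (possibly w = v) form a vertex cut, the graph splits along the edge uw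
    into two smaller 2-connected graphs without long paths between the ends of a suitable edge.
    The induction hypothesis and superadditivity finish this case.

  \<^item> Otherwise, consider the Kelmans switch, which replaces edges wy by xy where x and w are adjacent
    and y is not a neighbour of x. It loses no cliques and creates no longer u-v path, and it keeps
    the graph 2-connected when {x, w} is not a cut and x, w have a common neighbour (if x = u and
    there is none, then w may safely be joined to v as well). As switches towards u, v and a increase
    the potential, extremality makes u and v dominating, that is, adjacent to all other vertices;
    then a is dominating too.

  \<^item> Extremality also gives saturation: a new edge creates a long path. So in G - v, where u and a
    are dominating, any two nonadjacent vertices are joined by a path on at least k - 1 vertices, while
    no cycle is that long. A closing argument in the style of Posa and Kopylov then shows that
    nonadjacent vertices x \<in> X and y \<in> Y cannot both have large degree into X and into Y. Deleting
    vertices of small degree as long as possible, once with threshold about k/2 and once with a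
    threshold complementary to the order of a maximum clique, therefore ends in a clique of order
    m - b + 2, all other vertices having been deleted with degree at most b + 2, where 2b + 1 \<le> m.
    The resulting bound is at most the block sum because w is convex.
\<close>

section \<open>Block sums of a convex weight\<close>

text \<open>
  Sorting A increasingly, its i-th element is at least i.
\<close>
lemma sum_initial_segment_le:
  fixes w :: "nat \<Rightarrow> nat"
  assumes "mono w" "finite A"
  shows "(\<Sum>i<card A. w i) \<le> sum w A"
  using assms(2)
proof (induction rule: finite_linorder_max_induct)
  case empty
  then show ?case by simp
next
  case (insert b A)
  have "A \<subseteq> {..<b}" using insert.hyps by auto
  then have "card A \<le> b" by (metis card_lessThan card_mono finite_lessThan)
  then have "w (card A) \<le> w b" using assms(1) by (simp add: monoD)
  moreover have "b \<notin> A" using insert.hyps by auto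
  ultimately show ?case using insert by simp
qed

text \<open>
  The bound as a function of the number N of vertices other than u and v: they fill consecutive
  blocks of length m, and only the last block may be incomplete.
\<close>
definition block_sum :: "(nat \<Rightarrow> nat) \<Rightarrow> nat \<Rightarrow> nat \<Rightarrow> nat" where
  "block_sum w m N = (\<Sum>i<N. w (i mod m))"

lemma sum_lessThan_add:
  fixes f :: "nat \<Rightarrow> 'b::comm_monoid_add"
  shows "(\<Sum>i<a + b. f i) = (\<Sum>i<a. f i) + (\<Sum>i<b. f (a + i))"
  by (induction b) (simp_all add: algebra_simps)

text \<open>
  A window of at most m consecutive indices has distinct residues, so its weight is smallest when
  the residues are an initial segment. From a longer window, a full period is split off.
\<close>
lemma block_sum_window:
  assumes "mono w" "0 < m"
  shows "block_sum w m b \<le> (\<Sum>i<b. w ((a + i) mod m))"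
proof -
  have short: "block_sum w m b \<le> (\<Sum>i<b. w ((a + i) mod m))" if "b \<le> m" for b
  proof -
    have inj: "inj_on (\<lambda>i. (a + i) mod m) {..<b}"
    proof (rule inj_onI)
      fix i j assume "i \<in> {..<b}" "j \<in> {..<b}" and eq: "(a + i) mod m = (a + j) mod m"
      then have "i < m" "j < m" using that by auto
      moreover have "m dvd int i - int j"
        using eq mod_eq_dvd_iff[of "int (a + i)" "int m" "int (a + j)"]
        by (metis add_diff_cancel_left of_nat_add of_nat_mod)
      ultimately show "i = j" using dvd_imp_le_int[of "int i - int j" "int m"] by fastforce
    qed
    have "block_sum w m b = (\<Sum>i<b. w i)"
      unfolding block_sum_def using that by (intro sum.cong) auto
    also have "\<dots> = (\<Sum>i<card ((\<lambda>i. (a + i) mod m) ` {..<b}). w i)"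
      using inj by (simp add: card_image)
    also have "\<dots> \<le> sum w ((\<lambda>i. (a + i) mod m) ` {..<b})"
      by (rule sum_initial_segment_le[OF assms(1)]) simp
    also have "\<dots> = (\<Sum>i<b. w ((a + i) mod m))"
      using inj by (simp add: sum.reindex)
    finally show ?thesis .
  qed
  show ?thesis
  proof (induction b rule: less_induct)
    case (less b)
    show ?case
    proof (cases "b \<le> m")
      case True
      then show ?thesis by (rule short)
    next
      case False
      then obtain c where b: "b = m + c" using le_Suc_ex nat_le_linear by blast
      have "block_sum w m b = block_sum w m m + block_sum w m c"
        unfolding b block_sum_def by (simp add: sum_lessThan_add)
      also have "\<dots> \<le> (\<Sum>i<m. w ((a + i) mod m)) + (\<Sum>i<c. w ((a + i) mod m))"
        using less[of c] short[of m] b assms(2) by simp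
      also have "(\<Sum>i<c. w ((a + i) mod m)) = (\<Sum>i<c. w ((a + (m + i)) mod m))"
        by (intro sum.cong refl) (metis add.left_commute mod_add_self1)
      also have "(\<Sum>i<m. w ((a + i) mod m)) + \<dots> = (\<Sum>i<b. w ((a + i) mod m))"
        unfolding b by (simp add: sum_lessThan_add)
      finally show ?thesis .
    qed
  qed
qed

lemma block_sum_superadditive:
  assumes "mono w" "0 < m"
  shows "block_sum w m a + block_sum w m b \<le> block_sum w m (a + b)"
  using block_sum_window[OF assms, of b a]
  by (simp add: block_sum_def sum_lessThan_add)

lemma block_sum_div_mod:
  "block_sum w m (q * m + t) = q * (\<Sum>i<m. w i) + block_sum w m t"
proof (induction q)
  case (Suc q)
  have "block_sum w m (Suc q * m + t) = block_sum w m (m + (q * m + t))"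
    by (simp add: algebra_simps)
  also have "\<dots> = block_sum w m m + block_sum w m (q * m + t)"
    unfolding block_sum_def by (simp add: sum_lessThan_add)
  also have "block_sum w m m = (\<Sum>i<m. w i)"
    unfolding block_sum_def by (intro sum.cong) auto
  finally show ?case using Suc by simp
qed simp

lemma block_sum_short: "t \<le> m \<Longrightarrow> block_sum w m t = (\<Sum>i<t. w i)"
  unfolding block_sum_def by (intro sum.cong) auto

text \<open>
  The number of s-cliques that a new vertex forms with i + 2 pairwise adjacent neighbours. The two
  extra neighbours are the ends of the prescribed edge.
\<close>
definition wt :: "nat \<Rightarrow> nat \<Rightarrow> nat" where
  "wt s i = (i + 2) choose (s - 1)"

lemma mono_wt: "mono (wt s)"
  unfolding wt_def by (intro monoI binomial_right_mono) simp

lemma sum_wt: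
  assumes "2 \<le> s"
  shows "(2 choose s) + (\<Sum>i<t. wt s i) = (t + 2) choose s"
proof (induction t)
  case (Suc t)
  obtain s' where "s = Suc s'" using assms by (cases s) auto
  with Suc show ?case by (simp add: wt_def)
qed (simp add: numeral_2_eq_2)

text \<open>
  Convexity of the weight in the form of a supporting line at a, whose slope is the increment
  from a to a + 1.
\<close>
lemma wt_subgradient:
  assumes "2 \<le> s"
  shows "int (wt s a) + (int i - int a) * int ((a + 2) choose (s - 2)) \<le> int (wt s i)"
proof -
  obtain r where s: "s = Suc (Suc r)" using assms by (metis add_2_eq_Suc le_Suc_ex)
  have step: "wt s (Suc i) = wt s i + ((i + 2) choose r)" for i
    by (simp add: wt_def s)
  have up: "int (wt s a) + int j * int ((a + 2) choose r) \<le> int (wt s (a + j))" for j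
  proof (induction j)
    case (Suc j)
    have "((a + 2) choose r) \<le> ((a + j + 2) choose r)" by (rule binomial_right_mono) simp
    with Suc step[of "a + j"] show ?case by (simp add: algebra_simps)
  qed simp
  have down: "int (wt s (i + j)) \<le> int (wt s i) + int j * int ((i + j + 2) choose r)" for i j
  proof (induction j)
    case (Suc j)
    have "((i + j + 2) choose r) \<le> ((i + Suc j + 2) choose r)" by (rule binomial_right_mono) simp
    then have "int j * int ((i + j + 2) choose r) + int ((i + j + 2) choose r) 
       \<le> int j * int ((i + Suc j + 2) choose r) + int ((i + Suc j + 2) choose r)"
      by (intro add_mono mult_left_mono) auto
    with Suc step[of "i + j"] show ?case by (simp add: algebra_simps)
  qed simp
  show ?thesis
  proof (cases "a \<le> i")
    case True
    then obtain j where "i = a + j" using le_Suc_ex by blast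
    then show ?thesis using up[of j] by (simp add: s)
  next
    case False
    then obtain j where "a = i + j" using le_Suc_ex nat_le_linear by blast
    then show ?thesis using down[of i j] by (simp add: s algebra_simps)
  qed
qed

lemma int_gauss_sum: "2 * (\<Sum>i<n. int i - c) = int n * (int n - 1 - 2 * c)"
  by (induction n) (simp_all add: algebra_simps)

lemma int_block_gauss_sum:
  assumes "t \<le> m"
  shows "2 * (\<Sum>i<q * m + t. int (i mod m) - c)
     = int q * (int m * (int m - 1 - 2 * c)) + int t * (int t - 1 - 2 * c)"
proof (induction q)
  case 0
  have "(\<Sum>i<t. int (i mod m) - c) = (\<Sum>i<t. int i - c)"
    using assms by (intro sum.cong) auto
  then show ?case by (simp add: int_gauss_sum)
next
  case (Suc q)
  have "(\<Sum>i<m + (q * m + t). int (i mod m) - c) 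
     = (\<Sum>i<m. int (i mod m) - c) + (\<Sum>i<q * m + t. int (i mod m) - c)"
    by (simp add: sum_lessThan_add)
  also have "(\<Sum>i<m. int (i mod m) - c) = (\<Sum>i<m. int i - c)"
    by (intro sum.cong) auto
  finally have "2 * (\<Sum>i<m + (q * m + t). int (i mod m) - c) 
    = int m * (int m - 1 - 2 * c) + 2 * (\<Sum>i<q * m + t. int (i mod m) - c)"
    by (simp only: distrib_left int_gauss_sum)
  then show ?case using Suc by (simp add: algebra_simps)
qed

text \<open>
  The linear case of the comparison below. For one full block and t further indices, twice the
  difference of the two sides is at least (a - t)(a - t + 1), a product of consecutive integers; the
  other full blocks contribute nonnegatively because the mean of 0, ..., m - 1 is at least a.
\<close>
lemma block_tail_nonneg:
  assumes "2 * a + 1 \<le> m" "m \<le> N"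
  shows "(\<Sum>i<m - a. int i - int a) \<le> (\<Sum>i<N. int (i mod m) - int a)"
proof -
  define q t where "q = N div m" and "t = N mod m"
  have m: "0 < m" using assms by simp
  have N: "N = q * m + t" by (simp add: q_def t_def)
  have q: "1 \<le> q" using assms m by (simp add: q_def div_greater_zero_iff Suc_leI)
  have "0 \<le> int m * (int m - 1 - 2 * int a)" using assms by (intro mult_nonneg_nonneg) auto
  then have "1 * (int m * (int m - 1 - 2 * int a)) \<le> int q * (int m * (int m - 1 - 2 * int a))"
    using q by (intro mult_right_mono) auto
  then have "int m * (int m - 1 - 2 * int a) + int t * (int t - 1 - 2 * int a)
      \<le> 2 * (\<Sum>i<N. int (i mod m) - int a)"
    unfolding N using m by (subst int_block_gauss_sum) (auto simp: t_def)
  moreover have "2 * (\<Sum>i<m - a. int i - int a) = (int m - int a) * (int m - 1 - 3 * int a)"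
    using assms by (subst int_gauss_sum) (simp add: of_nat_diff algebra_simps)
  moreover have "(int m - int a) * (int m - 1 - 3 * int a)
      \<le> int m * (int m - 1 - 2 * int a) + int t * (int t - 1 - 2 * int a)"
  proof -
    have "0 \<le> (int a - int t) * (int a - int t + 1)"
      by (cases "int a < int t") (auto intro: mult_nonneg_nonneg mult_nonpos_nonpos)
    moreover have "0 \<le> 2 * int a * (int m - 1 - 2 * int a)" using assms by (intro mult_nonneg_nonneg) auto
    ultimately show ?thesis by (simp add: algebra_simps)
  qed
  ultimately show ?thesis by linarith
qed

text \<open>
  A clique of order m - a + 2 together with further vertices that contribute the weight of index a
  each yields no more than the block construction. The first m - a indices of the block sum account
  for the clique; on the others, the supporting line of the weight at a reduces the claim to the
  linear case.
\<close>
lemma two_level_bound: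
  assumes s: "2 \<le> s" and "2 * a + 1 \<le> m" "m \<le> N"
  shows "((m - a + 2) choose s) + (N - (m - a)) * wt s a \<le> (2 choose s) + block_sum (wt s) m N"
proof -
  define D where "D = int ((a + 2) choose (s - 2))"
  define c where "c = m - a"
  have N: "N = c + (N - c)" using assms by (simp add: c_def)
  have split: "(\<Sum>i<N. f i) = (\<Sum>i<c. f i) + (\<Sum>i<N - c. f (c + i))" for f :: "nat \<Rightarrow> int"
    by (subst N) (rule sum_lessThan_add)
  have initial: "(\<Sum>i<c. f (i mod m)) = (\<Sum>i<c. f i)" for f :: "nat \<Rightarrow> int"
    by (intro sum.cong) (auto simp: c_def)
  have "0 \<le> (\<Sum>i<N - c. int ((c + i) mod m) - int a)"
    using block_tail_nonneg[OF assms(2,3)] split[of "\<lambda>i. int (i mod m) - int a"]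
      initial[of "\<lambda>i. int i - int a"] by (simp add: c_def)
  then have "0 \<le> (\<Sum>i<N - c. int ((c + i) mod m) - int a) * D"
    by (simp add: D_def)
  then have "int (N - c) * int (wt s a)
      \<le> (\<Sum>i<N - c. int (wt s a) + (int ((c + i) mod m) - int a) * D)"
    by (simp add: sum.distrib sum_distrib_right)
  also have "\<dots> \<le> (\<Sum>i<N - c. int (wt s ((c + i) mod m)))"
    unfolding D_def by (intro sum_mono wt_subgradient[OF s])
  finally have "int (N - c) * int (wt s a) \<le> (\<Sum>i<N - c. int (wt s ((c + i) mod m)))" .
  moreover have "int (block_sum (wt s) m N) 
     = (\<Sum>i<c. int (wt s i)) + (\<Sum>i<N - c. int (wt s ((c + i) mod m)))"
    using split[of "\<lambda>i. int (wt s (i mod m))"] initial[of "\<lambda>i. int (wt s i)"]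
    by (simp add: block_sum_def)
  moreover have "int ((c + 2) choose s) = int (2 choose s) + (\<Sum>i<c. int (wt s i))"
    using sum_wt[OF s, of c] by (metis of_nat_add of_nat_sum)
  ultimately have "int (((c + 2) choose s) + (N - c) * wt s a) \<le> int ((2 choose s) + block_sum (wt s) m N)"
    by simp
  then show ?thesis unfolding c_def by linarith
qed

lemma g_bound_eq_block_sum:
  assumes "4 \<le> k" "2 \<le> s"
  shows "g_bound s n k = (2 choose s) + block_sum (wt s) (k - 3) (n - 2)"
proof -
  define m where "m = k - 3"
  have m: "0 < m" "k - 1 = m + 2" using assms by (auto simp: m_def)
  define q t where "q = (n - 2) div m" and "t = (n - 2) mod m"
  have "n - 2 = q * m + t" by (simp add: q_def t_def)
  moreover have "t \<le> m" using m by (simp add: t_def)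
  ultimately have bs: "block_sum (wt s) m (n - 2) = q * (\<Sum>i<m. wt s i) + (\<Sum>i<t. wt s i)"
    by (simp add: block_sum_div_mod block_sum_short)
  show ?thesis
  proof (cases "s = 2")
    case True
    have two: "(\<Sum>i<j. wt 2 i) = (j choose 2) + 2 * j" for j
      by (induction j) (simp_all add: wt_def numeral_2_eq_2)
    have "2 * (n - 2) = q * (2 * m) + 2 * t" using \<open>n - 2 = q * m + t\<close> by simp
    then have "q * (m choose 2) + (t choose 2) + 2 * (n - 2) + 1 = 1 + block_sum (wt 2) m (n - 2)"
      using bs[unfolded True two] by (simp add: algebra_simps)
    then show ?thesis
      by (simp add: True g_bound_def m_def[symmetric] q_def[symmetric] t_def[symmetric] Let_def)
  next
    case False
    then have "2 choose s = 0" using assms by simp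
    then have "(\<Sum>i<j. wt s i) = (j + 2) choose s" for j
      using sum_wt[OF assms(2), of j] by linarith
    then show ?thesis
      using bs m \<open>2 choose s = 0\<close> False
      by (simp add: g_bound_def m_def[symmetric] q_def[symmetric] t_def[symmetric] Let_def)
  qed
qed

section \<open>Paths, connectivity and the Kelmans switch\<close>

definition simple_graph :: "'a set \<Rightarrow> ('a \<times> 'a) set \<Rightarrow> bool" where
  "simple_graph V E \<longleftrightarrow> finite V \<and> E \<subseteq> V \<times> V \<and> sym E \<and> irrefl E"

text \<open>
  Connectedness of the induced subgraph on A; the relation may have edges outside A, so that
  vertices can be deleted by shrinking A only.
\<close>
definition conn_on :: "'a set \<Rightarrow> ('a \<times> 'a) set \<Rightarrow> bool" where
  "conn_on A E \<longleftrightarrow> (\<forall>x\<in>A. \<forall>y\<in>A. (x, y) \<in> (E \<inter> A \<times> A)\<^sup>*)"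

text \<open>
  With at least three vertices, connectedness of all vertex-deleted subgraphs implies that the
  graph itself is connected.
\<close>
definition biconnected :: "'a set \<Rightarrow> ('a \<times> 'a) set \<Rightarrow> bool" where
  "biconnected V E \<longleftrightarrow> 3 \<le> card V \<and> (\<forall>c\<in>V. conn_on (V - {c}) E)"

definition path_between :: "('a \<times> 'a) set \<Rightarrow> 'a \<Rightarrow> 'a list \<Rightarrow> 'a \<Rightarrow> bool" where
  "path_between E u p v \<longleftrightarrow>
     p \<noteq> [] \<and> hd p = u \<and> last p = v \<and> distinct p \<and> successively (\<lambda>x y. (x, y) \<in> E) p"

definition cliques :: "nat \<Rightarrow> 'a set \<Rightarrow> ('a \<times> 'a) set \<Rightarrow> 'a set set" where
  "cliques s A E = {C. C \<subseteq> A \<and> card C = s \<and> (\<forall>x\<in>C. \<forall>y\<in>C. x \<noteq> y \<longrightarrow> (x, y) \<in> E)}"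

lemma finite_cliques: "finite A \<Longrightarrow> finite (cliques s A E)"
  by (rule finite_subset[of _ "Pow A"]) (auto simp: cliques_def)

lemma conn_on_refine:
  assumes "conn_on A E" "\<And>p q. (p, q) \<in> E \<inter> A \<times> A \<Longrightarrow> (p, q) \<in> (E' \<inter> A \<times> A)\<^sup>*"
  shows "conn_on A E'"
proof -
  have "E \<inter> A \<times> A \<subseteq> (E' \<inter> A \<times> A)\<^sup>*" using assms(2) by auto
  then have "(E \<inter> A \<times> A)\<^sup>* \<subseteq> (E' \<inter> A \<times> A)\<^sup>*" by (rule rtrancl_subset_rtrancl)
  then show ?thesis using assms(1) unfolding conn_on_def by blast
qed

lemma conn_on_mono: "conn_on A E \<Longrightarrow> E \<subseteq> E' \<Longrightarrow> conn_on A E'"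
  by (rule conn_on_refine) auto

lemma biconnected_mono: "biconnected V E \<Longrightarrow> E \<subseteq> E' \<Longrightarrow> biconnected V E'"
  unfolding biconnected_def using conn_on_mono by blast

lemma path_between_rev:
  assumes "sym E" "path_between E u p v"
  shows "path_between E v (rev p) u"
proof -
  have "successively (\<lambda>x y. (y, x) \<in> E) p"
    using assms by (auto simp: path_between_def elim!: successively_mono dest: symD)
  then show ?thesis using assms(2) by (auto simp: path_between_def hd_rev last_rev)
qed

lemma path_between_mono:
  "path_between E u p v \<Longrightarrow> (\<And>x y. x \<in> set p \<Longrightarrow> y \<in> set p \<Longrightarrow> (x, y) \<in> E \<Longrightarrow> (x, y) \<in> E') \<Longrightarrow>
   path_between E' u p v"
  unfolding path_between_def by (blast intro: successively_mono)

lemma path_of_reachable: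
  assumes "(x, y) \<in> (E \<inter> A \<times> A)\<^sup>*" "x \<in> A"
  shows "\<exists>p. path_between E x p y \<and> set p \<subseteq> A"
  using assms(1)
proof (induction rule: rtrancl_induct)
  case base
  show ?case using assms(2) by (intro exI[of _ "[x]"]) (simp add: path_between_def)
next
  case (step y z)
  then obtain p where p: "path_between E x p y" "set p \<subseteq> A" by blast
  show ?case
  proof (cases "z \<in> set p")
    case True
    then obtain ps qs where "p = ps @ z # qs" by (meson split_list)
    then show ?thesis using p
      by (intro exI[of _ "ps @ [z]"])
        (auto simp: path_between_def successively_append_iff hd_append)
  next
    case False
    then show ?thesis using p step.hyps
      by (intro exI[of _ "p @ [z]"]) (auto simp: path_between_def successively_append_iff)
  qed
qed

definition private_nbrs :: "('a \<times> 'a) set \<Rightarrow> 'a \<Rightarrow> 'a \<Rightarrow> 'a set" where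
  "private_nbrs E x w = {y. (w, y) \<in> E \<and> y \<noteq> x \<and> (x, y) \<notin> E}"

text \<open>
  The Kelmans transformation: if xw is an edge, then afterwards the neighbourhood of w is contained
  in that of x, apart from x itself.
\<close>
definition switch :: "('a \<times> 'a) set \<Rightarrow> 'a \<Rightarrow> 'a \<Rightarrow> ('a \<times> 'a) set" where
  "switch E x w = (E - ({w} \<times> private_nbrs E x w \<union> private_nbrs E x w \<times> {w}))
     \<union> ({x} \<times> private_nbrs E x w \<union> private_nbrs E x w \<times> {x})"

context
  fixes E :: "('a \<times> 'a) set" and x w :: 'a
  assumes sym: "sym E" and irrefl: "irrefl E" and edge: "(x, w) \<in> E"
begin

lemma switch_ne: "x \<noteq> w" "(w, x) \<in> E" "(p, p) \<notin> E"
  using sym irrefl edge by (auto dest: symD simp: irrefl_def)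

lemma switch_sym: "sym (switch E x w)"
  using sym unfolding switch_def sym_def by blast

lemma switch_irrefl: "irrefl (switch E x w)"
  using irrefl unfolding switch_def irrefl_def private_nbrs_def by blast

lemma switch_others: "p \<notin> {x, w} \<Longrightarrow> q \<notin> {x, w} \<Longrightarrow> (p, q) \<in> switch E x w \<longleftrightarrow> (p, q) \<in> E"
  unfolding switch_def by auto

lemma switch_x: "q \<noteq> w \<Longrightarrow> (x, q) \<in> switch E x w \<longleftrightarrow> q \<noteq> x \<and> ((x, q) \<in> E \<or> (w, q) \<in> E)"
  using switch_ne unfolding switch_def private_nbrs_def by auto

lemma switch_w: "q \<noteq> x \<Longrightarrow> (w, q) \<in> switch E x w \<longleftrightarrow> (x, q) \<in> E \<and> (w, q) \<in> E"
  using switch_ne unfolding switch_def private_nbrs_def by auto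

lemma switch_xw: "(x, w) \<in> switch E x w" "(w, x) \<in> switch E x w"
  using switch_ne edge unfolding switch_def private_nbrs_def by auto

lemma switch_x': "q \<noteq> w \<Longrightarrow> (q, x) \<in> switch E x w \<longleftrightarrow> q \<noteq> x \<and> ((q, x) \<in> E \<or> (q, w) \<in> E)"
  using switch_x[of q] switch_sym sym by (metis symE)

lemma switch_w': "q \<noteq> x \<Longrightarrow> (q, w) \<in> switch E x w \<longleftrightarrow> (q, x) \<in> E \<and> (q, w) \<in> E"
  using switch_w[of q] switch_sym sym by (metis symE)

lemma successively_switch_others:
  assumes "set l \<inter> {x, w} = {}"
  shows "successively (\<lambda>a b. (a, b) \<in> switch E x w) l = successively (\<lambda>a b. (a, b) \<in> E) l"
  using assms by (intro successively_cong refl switch_others) auto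

text \<open>
  In the new graph both path neighbours of w are old neighbours of x and of w, while each path
  neighbour of x is an old neighbour of x or of w. Exchanging x and w, reversing the segment
  between them, or both, therefore repairs the path in the old graph, keeping its ends.
\<close>
lemma switch_path_ordered:
  assumes path: "path_between (switch E x w) u (xs @ x # ys @ w # zs) v" and "w \<noteq> v"
  shows "\<exists>q. path_between E u q v \<and> length q = length (xs @ x # ys @ w # zs)"
proof -
  note sw = path[unfolded path_between_def]
  have ne: "zs \<noteq> []" using sw assms(2) by auto
  have dis: "set xs \<inter> {x, w} = {}" "set ys \<inter> {x, w} = {}" "set zs \<inter> {x, w} = {}"
    using sw by auto
  note suc = sw[unfolded successively_append_iff successively_Cons]
  have lists: "successively (\<lambda>a b. (a, b) \<in> E) xs" "successively (\<lambda>a b. (a, b) \<in> E) ys"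
      "successively (\<lambda>a b. (a, b) \<in> E) zs"
    using suc dis by (auto simp: successively_switch_others successively_append_iff successively_Cons)
  have lists': "successively (\<lambda>a b. (b, a) \<in> E) ys"
    using lists(2) sym by (auto elim!: successively_mono dest: symD)
  have ends: "l \<noteq> [] \<Longrightarrow> last l \<noteq> x \<and> last l \<noteq> w \<and> hd l \<noteq> x \<and> hd l \<noteq> w" if "set l \<inter> {x, w} = {}" for l
    using that last_in_set[of l] hd_in_set[of l] by (metis disjoint_insert(1) disjoint_iff insertCI)
  have l: "xs \<noteq> [] \<Longrightarrow> (last xs, x) \<in> E \<or> (last xs, w) \<in> E"
    using suc ends[OF dis(1)] switch_x'[of "last xs"] by auto
  have m: "ys \<noteq> [] \<Longrightarrow> (x, hd ys) \<in> E \<or> (w, hd ys) \<in> E"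
    using suc ends[OF dis(2)] switch_x[of "hd ys"] by auto
  have m': "ys \<noteq> [] \<Longrightarrow> (last ys, x) \<in> E \<and> (last ys, w) \<in> E"
    using suc ends[OF dis(2)] switch_w'[of "last ys"]
    by (auto simp: successively_append_iff successively_Cons)
  have r: "(x, hd zs) \<in> E \<and> (w, hd zs) \<in> E"
    using suc ends[OF dis(3)] switch_w[of "hd zs"] ne
    by (auto simp: successively_append_iff successively_Cons)
  have m'': "ys \<noteq> [] \<Longrightarrow> (x, last ys) \<in> E \<and> (w, last ys) \<in> E"
       "ys \<noteq> [] \<Longrightarrow> (hd ys, x) \<in> E \<or> (hd ys, w) \<in> E"
    using m m' sym by (auto dest: symD)
  note rules = path_between_def successively_append_iff successively_Cons hd_append hd_rev last_rev
  consider "xs \<noteq> [] \<Longrightarrow> (last xs, x) \<in> E" "ys \<noteq> [] \<Longrightarrow> (x, hd ys) \<in> E"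
    | "xs \<noteq> [] \<Longrightarrow> (last xs, x) \<in> E" "ys \<noteq> []" "(w, hd ys) \<in> E"
    | "xs \<noteq> []" "(last xs, w) \<in> E" "ys \<noteq> [] \<Longrightarrow> (x, hd ys) \<in> E"
    | "xs \<noteq> []" "(last xs, w) \<in> E" "ys \<noteq> []" "(w, hd ys) \<in> E"
    using l m by blast
  then show ?thesis
  proof cases
    case 1
    then have "path_between E u (xs @ x # ys @ w # zs) v"
      using sw lists m' r ne edge by (auto simp: rules)
    then show ?thesis by blast
  next
    case 2
    moreover from this have "(hd ys, w) \<in> E" "(x, last ys) \<in> E" using m'' sym by (auto dest: symD)
    ultimately have "path_between E u (xs @ x # rev ys @ w # zs) v"
      using sw lists lists' r ne by (auto simp: rules)
    then show ?thesis by (intro exI conjI) auto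
  next
    case 3
    moreover from this have "ys \<noteq> [] \<Longrightarrow> (hd ys, x) \<in> E \<and> (w, last ys) \<in> E"
      using m'' sym by (auto dest: symD)
    ultimately have "path_between E u (xs @ w # rev ys @ x # zs) v"
      using sw lists lists' r ne switch_ne(2) by (auto simp: rules)
    then show ?thesis by (intro exI conjI) auto
  next
    case 4
    then have "path_between E u (xs @ w # ys @ x # zs) v"
      using sw lists m' m'' r ne by (auto simp: rules)
    then show ?thesis by (intro exI conjI) auto
  qed
qed

text \<open>
  Each path neighbour of x is an old neighbour of x or of w. If both are neighbours of the same
  one of them, it takes the place of x; otherwise the edge between x and w is inserted.
\<close>
lemma switch_path_only_x:
  assumes path: "path_between (switch E x w) u (xs @ x # zs) v" and w: "w \<notin> set xs" "w \<notin> set zs"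
  shows "\<exists>q. path_between E u q v \<and> length (xs @ x # zs) \<le> length q"
proof -
  note sw = path[unfolded path_between_def]
  have dis: "set xs \<inter> {x, w} = {}" "set zs \<inter> {x, w} = {}"
    using sw w by auto
  note suc = sw[unfolded successively_append_iff successively_Cons]
  have lists: "successively (\<lambda>a b. (a, b) \<in> E) xs" "successively (\<lambda>a b. (a, b) \<in> E) zs"
    using suc dis by (auto simp: successively_switch_others successively_append_iff successively_Cons)
  have ends: "l \<noteq> [] \<Longrightarrow> last l \<noteq> x \<and> last l \<noteq> w \<and> hd l \<noteq> x \<and> hd l \<noteq> w" if "set l \<inter> {x, w} = {}" for l
    using that last_in_set[of l] hd_in_set[of l] by (metis disjoint_insert(1) disjoint_iff insertCI)
  have l: "xs \<noteq> [] \<Longrightarrow> (last xs, x) \<in> E \<or> (last xs, w) \<in> E"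
    using suc ends[OF dis(1)] switch_x'[of "last xs"] by auto
  have r: "zs \<noteq> [] \<Longrightarrow> (x, hd zs) \<in> E \<or> (w, hd zs) \<in> E"
    using suc ends[OF dis(2)] switch_x[of "hd zs"] by auto
  note rules = path_between_def successively_append_iff successively_Cons hd_append hd_rev last_rev
  consider "xs \<noteq> [] \<Longrightarrow> (last xs, x) \<in> E" "zs \<noteq> [] \<Longrightarrow> (x, hd zs) \<in> E"
    | "xs \<noteq> [] \<Longrightarrow> (last xs, x) \<in> E" "zs \<noteq> []" "(w, hd zs) \<in> E"
    | "xs \<noteq> []" "(last xs, w) \<in> E" "zs \<noteq> [] \<Longrightarrow> (x, hd zs) \<in> E"
    | "xs \<noteq> []" "(last xs, w) \<in> E" "zs \<noteq> []" "(w, hd zs) \<in> E"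
    using l r by blast
  then show ?thesis
  proof cases
    case 1
    then have "path_between E u (xs @ x # zs) v"
      using sw lists by (auto simp: rules)
    then show ?thesis by blast
  next
    case 2
    then have "path_between E u (xs @ x # w # zs) v"
      using sw lists edge w switch_ne by (auto simp: rules)
    then show ?thesis by (intro exI conjI) auto
  next
    case 3
    then have "path_between E u (xs @ w # x # zs) v"
      using sw lists edge w switch_ne by (auto simp: rules)
    then show ?thesis by (intro exI conjI) auto
  next
    case 4
    then have "path_between E u (xs @ w # zs) v"
      using sw lists w by (auto simp: rules)
    then show ?thesis by (intro exI conjI) auto
  qed
qed

text \<open>
  The two preceding lemmas cover the paths through x, where the path is reversed if w comes before x.
  Paths that avoid x use old edges only.
\<close>
lemma switch_path:
  assumes path: "path_between (switch E x w) u p v" and "w \<noteq> u" "w \<noteq> v"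
  shows "\<exists>q. path_between E u q v \<and> length p \<le> length q"
proof -
  have dis: "distinct p" using path by (simp add: path_between_def)
  consider "x \<notin> set p" | "x \<in> set p" "w \<notin> set p" | "x \<in> set p" "w \<in> set p" by blast
  then show ?thesis
  proof cases
    case 1
    have "path_between E u p v"
      using path
    proof (rule path_between_mono)
      fix a b assume "a \<in> set p" "b \<in> set p" "(a, b) \<in> switch E x w"
      moreover from this 1 have "a \<noteq> x" "b \<noteq> x" by auto
      ultimately show "(a, b) \<in> E" by (auto simp: switch_def)
    qed
    then show ?thesis by blast
  next
    case 2
    then obtain xs zs where "p = xs @ x # zs" by (meson split_list)
    then show ?thesis using switch_path_only_x[of u xs zs v] path 2 by auto
  next
    case 3
    then obtain xs rs where p: "p = xs @ x # rs" by (meson split_list)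
    show ?thesis
    proof (cases "w \<in> set rs")
      case True
      then obtain ys zs where "rs = ys @ w # zs" by (meson split_list)
      then show ?thesis using switch_path_ordered[of u xs ys zs v] path assms p by fastforce
    next
      case False
      then have "w \<in> set xs" using 3 p switch_ne by auto
      then obtain as ys where "xs = as @ w # ys" by (meson split_list)
      then have "rev p = rev rs @ x # rev ys @ w # rev as" by (simp add: p)
      moreover have "path_between (switch E x w) v (rev p) u"
        using path switch_sym by (simp add: path_between_rev)
      ultimately obtain q where "path_between E v q u" "length q = length (rev p)"
        using switch_path_ordered[of v "rev rs" "rev ys" "rev as" u] assms by auto
      then show ?thesis using path_between_rev[OF sym] by (intro exI[of _ "rev q"]) simp
    qed
  qed
qed

text \<open>
  A clique destroyed by the switch contains w and a private neighbour of w, so it misses x, and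
  replacing w by x gives a clique of the new graph. This is not an old clique because x was not
  adjacent to the private neighbour, so the map is injective.
\<close>
lemma switch_cliques:
  assumes "finite A" "x \<in> A"
  shows "card (cliques s A E) \<le> card (cliques s A (switch E x w))"
proof -
  define f where "f C = (if C \<in> cliques s A (switch E x w) then C else insert x (C - {w}))" for C
  have fin: "finite (cliques s A E')" for E'
    by (rule finite_cliques[OF assms(1)])
  have moved: "w \<in> C \<and> x \<notin> C \<and> insert x (C - {w}) \<in> cliques s A (switch E x w)
      \<and> insert x (C - {w}) \<notin> cliques s A E"
    if C: "C \<in> cliques s A E" and new: "C \<notin> cliques s A (switch E x w)" for C
  proof -
    have finC: "finite C" using C assms(1) by (auto simp: cliques_def intro: finite_subset)
    obtain a b where ab: "a \<in> C" "b \<in> C" "a \<noteq> b" "(a, b) \<notin> switch E x w" "(a, b) \<in> E"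
      using C new unfolding cliques_def by blast
    then have "\<exists>y\<in>C. y \<in> private_nbrs E x w \<and> w \<in> C" unfolding switch_def by blast
    then obtain y where y: "y \<in> C" "(w, y) \<in> E" "y \<noteq> x" "(x, y) \<notin> E" "w \<in> C"
      unfolding private_nbrs_def by blast
    have "\<forall>a\<in>C. \<forall>b\<in>C. a \<noteq> b \<longrightarrow> (a, b) \<in> E" using C by (simp add: cliques_def)
    then have x: "x \<notin> C" using y(1,3,4) by auto
    have "card (C - {w}) = s - 1" "0 < s" using y C finC by (auto simp: cliques_def card_gt_0_iff)
    then have "card (insert x (C - {w})) = s" using x finC by simp
    moreover have "(a, b) \<in> switch E x w" if a: "a \<in> insert x (C - {w})" and b: "b \<in> insert x (C - {w})" and "a \<noteq> b" for a b
    proof -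
      have edges: "(c, d) \<in> E" if "c \<in> C" "d \<in> C" "c \<noteq> d" for c d
        using C that by (auto simp: cliques_def)
      consider "a = x" "b \<in> C" "b \<noteq> w" | "b = x" "a \<in> C" "a \<noteq> w" | "a \<in> C - {w}" "b \<in> C - {w}"
        using a b \<open>a \<noteq> b\<close> by blast
      then show ?thesis
      proof cases
        case 1
        then show ?thesis using edges[of w b] y switch_x[of b] \<open>a \<noteq> b\<close> by simp
      next
        case 2
        then show ?thesis using edges[of a w] y switch_x'[of a] \<open>a \<noteq> b\<close> by simp
      next
        case 3
        then have "a \<notin> {x, w}" "b \<notin> {x, w}" using x by auto
        then show ?thesis using edges[of a b] 3 \<open>a \<noteq> b\<close> switch_others[of a b] by simp
      qed
    qed
    moreover have "insert x (C - {w}) \<subseteq> A" using C assms(2) unfolding cliques_def by blast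
    ultimately have "insert x (C - {w}) \<in> cliques s A (switch E x w)"
      unfolding cliques_def mem_Collect_eq by (intro conjI ballI impI)
    moreover have "y \<in> insert x (C - {w})" using y(1,2) switch_ne(3) by auto
    then have "insert x (C - {w}) \<notin> cliques s A E"
      using y(3,4) by (auto simp: cliques_def)
    ultimately show ?thesis using x y by blast
  qed
  have "inj_on f (cliques s A E)"
  proof (rule inj_onI)
    fix C D assume CD: "C \<in> cliques s A E" "D \<in> cliques s A E" and eq: "f C = f D"
    consider "C \<in> cliques s A (switch E x w)" "D \<in> cliques s A (switch E x w)"
      | "C \<notin> cliques s A (switch E x w)" "D \<notin> cliques s A (switch E x w)"
      | "C \<in> cliques s A (switch E x w)" "D \<notin> cliques s A (switch E x w)"
      | "C \<notin> cliques s A (switch E x w)" "D \<in> cliques s A (switch E x w)" by blast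
    then show "C = D"
    proof cases
      case 2
      have "C = insert w (f C - {x})" "D = insert w (f D - {x})"
        using moved[OF CD(1) 2(1)] moved[OF CD(2) 2(2)] 2 unfolding f_def by auto
      then show ?thesis using eq by simp
    next
      case 3
      then show ?thesis using moved[OF CD(2) 3(2)] CD eq unfolding f_def by metis
    next
      case 4
      then show ?thesis using moved[OF CD(1) 4(1)] CD eq unfolding f_def by metis
    qed (use eq in \<open>simp add: f_def\<close>)
  qed
  moreover have "f ` cliques s A E \<subseteq> cliques s A (switch E x w)"
    using moved by (auto simp: f_def)
  ultimately show ?thesis using fin by (rule card_inj_on_le)
qed

text \<open>
  Deleting any vertex but x is harmless because a moved edge wy can be replaced by the walk
  w, x, y. After deleting x, the vertex w needs to keep some neighbour y, and the remaining vertices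
  need to be connected among themselves. If x and w have no common neighbour, the neighbour y comes
  from an additional edge of E'.
\<close>
lemma switch_biconnected:
  assumes bic: "biconnected V E" and "switch E x w \<subseteq> E'" "sym E'"
    and conn: "conn_on (V - {x, w}) E" and y: "y \<in> V - {x, w}" "(w, y) \<in> E'" and xw: "x \<in> V" "w \<in> V"
  shows "biconnected V E'"
proof -
  have "conn_on (V - {c}) E'" if c: "c \<in> V" for c
  proof (cases "c = x")
    case False
    have "conn_on (V - {c}) E" using bic c by (simp add: biconnected_def)
    then show ?thesis
    proof (rule conn_on_refine)
      fix p q assume pq: "(p, q) \<in> E \<inter> (V - {c}) \<times> (V - {c})"
      let ?R = "E' \<inter> (V - {c}) \<times> (V - {c})"
      have detour: "(w, b) \<in> ?R\<^sup>*" "(b, w) \<in> ?R\<^sup>*" if "b \<in> private_nbrs E x w" "w \<noteq> c" "b \<in> V - {c}" for b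
      proof -
        have "(w, x) \<in> ?R" "(x, b) \<in> ?R" "(x, w) \<in> ?R" "(b, x) \<in> ?R"
          using that False xw assms(2) switch_xw by (auto simp: switch_def)
        then show "(w, b) \<in> ?R\<^sup>*" "(b, w) \<in> ?R\<^sup>*" by (meson converse_rtrancl_into_rtrancl r_into_rtrancl)+
      qed
      show "(p, q) \<in> ?R\<^sup>*"
      proof (cases "(p, q) \<in> switch E x w")
        case True
        then show ?thesis using pq assms(2) by auto
      next
        case False
        then show ?thesis using pq detour by (auto simp: switch_def)
      qed
    qed
  next
    case True
    let ?R = "E' \<inter> (V - {x}) \<times> (V - {x})"
    have "conn_on (V - {x, w}) E'"
      using conn by (rule conn_on_refine) (use assms(2) switch_others in fastforce)
    moreover have "E' \<inter> (V - {x, w}) \<times> (V - {x, w}) \<subseteq> ?R" by auto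
    ultimately have inner: "(p, q) \<in> ?R\<^sup>*" if "p \<in> V - {x, w}" "q \<in> V - {x, w}" for p q
      using that rtrancl_mono unfolding conn_on_def by blast
    have wy: "(w, y) \<in> ?R" "(y, w) \<in> ?R" using y xw switch_ne symD[OF assms(3)] by auto
    have toy: "(p, y) \<in> ?R\<^sup>*" "(y, p) \<in> ?R\<^sup>*" if "p \<in> V - {x}" for p
      using that wy inner[of p y] inner[of y p] y by (cases "p = w"; blast)+
    have "conn_on (V - {x}) E'"
      unfolding conn_on_def using toy by (meson rtrancl_trans)
    then show ?thesis using True by simp
  qed
  then show ?thesis using bic by (simp add: biconnected_def)
qed

end

section \<open>Splitting along an edge whose ends form a cut\<close>

lemma restrict_within: "B \<subseteq> A \<Longrightarrow> (E \<inter> A \<times> A) \<inter> B \<times> B = E \<inter> B \<times> B"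
  by auto

lemma conn_on_restrict: "B \<subseteq> A \<Longrightarrow> conn_on B (E \<inter> A \<times> A) = conn_on B E"
  by (simp add: conn_on_def restrict_within)

lemma cliques_restrict: "cliques s A (E \<inter> A \<times> A) = cliques s A E"
  by (auto simp: cliques_def)

lemma simple_graph_restrict: "simple_graph V E \<Longrightarrow> A \<subseteq> V \<Longrightarrow> simple_graph A (E \<inter> A \<times> A)"
  by (auto simp: simple_graph_def sym_def irrefl_def intro: finite_subset)

lemma path_subset:
  assumes "path_between E u p v" "E \<subseteq> A \<times> A" "u \<in> A"
  shows "set p \<subseteq> A"
proof -
  have "set l \<subseteq> A" if "successively (\<lambda>x y. (x, y) \<in> E) l" "l \<noteq> []" "hd l \<in> A" for l
    using that
  proof (induction l)
    case (Cons a l)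
    show ?case
    proof (cases "l = []")
      case False
      with Cons.prems have "(a, hd l) \<in> E" by (simp add: successively_Cons)
      then have "hd l \<in> A" using assms(2) by blast
      then show ?thesis using Cons False by (simp add: successively_Cons)
    qed (use Cons.prems in simp)
  qed simp
  then show ?thesis using assms by (auto simp: path_between_def)
qed

text \<open>
  A set A that can be left only through u and w induces a 2-connected graph if uw is an edge: a
  walk in the whole graph that avoids a vertex reaches u or w before it leaves A, and u and w are
  adjacent.
\<close>
lemma biconnected_side:
  assumes G: "simple_graph V E" "biconnected V E" and uw: "(u, w) \<in> E"
    and A: "A \<subseteq> V" "u \<in> A" "w \<in> A" "z \<in> A - {u, w}"
    and closed: "\<And>p q. (p, q) \<in> E \<Longrightarrow> p \<in> A - {u, w} \<Longrightarrow> q \<in> A"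
  shows "biconnected A (E \<inter> A \<times> A)"
proof -
  have sym: "sym E" and fin: "finite A" and ne: "u \<noteq> w"
    using G A uw by (auto simp: simple_graph_def irrefl_def intro: finite_subset)
  have "card {u, w, z} \<le> card A" using A fin by (intro card_mono) auto
  then have three: "3 \<le> card A" using A ne by auto
  have "conn_on (A - {c}) E" if c: "c \<in> A" for c
  proof -
    define R where "R = E \<inter> (A - {c}) \<times> (A - {c})"
    have symR: "sym (R\<^sup>*)" using sym by (intro sym_rtrancl) (auto simp: R_def sym_def)
    obtain t where t: "t \<in> {u, w} - {c}" using ne by blast
    have reach: "\<exists>t'\<in>{u, w} - {c}. (a, t') \<in> R\<^sup>*" if a: "a \<in> A - {c}" for a
    proof -
      have "conn_on (V - {c}) E" using G(2) c A by (auto simp: biconnected_def)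
      then have "(a, t) \<in> (E \<inter> (V - {c}) \<times> (V - {c}))\<^sup>*"
        using a t A by (auto simp: conn_on_def)
      then show ?thesis using a
      proof (induction rule: converse_rtrancl_induct)
        case base
        then show ?case using t by blast
      next
        case (step a b)
        show ?case
        proof (cases "a \<in> {u, w}")
          case True
          then show ?thesis using step.prems by blast
        next
          case False
          then have "b \<in> A - {c}" using step closed[of a b] by auto
          moreover from this have "(a, b) \<in> R" using step by (auto simp: R_def)
          ultimately show ?thesis using step.IH by (meson converse_rtrancl_into_rtrancl)
        qed
      qed
    qed
    have terminals: "(s, t') \<in> R\<^sup>*" if "s \<in> {u, w} - {c}" "t' \<in> {u, w} - {c}" for s t'
    proof (cases "s = t'")
      case False
      then have "(s, t') \<in> R" using that uw sym A by (auto simp: R_def dest: symD)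
      then show ?thesis by blast
    qed simp
    show ?thesis
      unfolding conn_on_def R_def[symmetric]
    proof (intro ballI)
      fix a b assume "a \<in> A - {c}" "b \<in> A - {c}"
      then obtain s t' where "s \<in> {u, w} - {c}" "(a, s) \<in> R\<^sup>*" "t' \<in> {u, w} - {c}" "(b, t') \<in> R\<^sup>*"
        using reach by meson
      then show "(a, b) \<in> R\<^sup>*"
        using terminals symR by (meson rtrancl_trans symD)
    qed
  qed
  then show ?thesis using three by (simp add: biconnected_def conn_on_restrict)
qed

text \<open>
  No clique meets both sides outside {u, w}, and the s-cliques common to both sides are the
  s-subsets of the edge {u, w}.
\<close>
lemma card_cliques_glue:
  assumes G: "simple_graph V E" and uw: "(u, w) \<in> E" and s: "2 \<le> s"
    and AB: "A \<union> B = V" "A \<inter> B = {u, w}"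
    and closed: "\<And>p q. (p, q) \<in> E \<Longrightarrow> p \<in> A - {u, w} \<Longrightarrow> q \<in> A"
  shows "card (cliques s V E) + (2 choose s) = card (cliques s A E) + card (cliques s B E)"
proof -
  have sym: "sym E" and fin: "finite V" and ne: "u \<noteq> w"
    using G uw by (auto simp: simple_graph_def irrefl_def)
  have sub: "C \<subseteq> A \<or> C \<subseteq> B" if "C \<in> cliques s V E" for C
  proof (rule ccontr)
    assume "\<not> ?thesis"
    then obtain p q where "p \<in> C" "p \<notin> B" "q \<in> C" "q \<notin> A" by blast
    moreover from this that AB have "p \<in> A - {u, w}" "p \<noteq> q"
      by (auto simp: cliques_def)
    moreover from calculation that have "(p, q) \<in> E" by (simp add: cliques_def)
    ultimately show False using closed by blast
  qed
  have "cliques s V E = cliques s A E \<union> cliques s B E"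
  proof
    show "cliques s V E \<subseteq> cliques s A E \<union> cliques s B E"
      using sub by (auto simp: cliques_def)
    show "cliques s A E \<union> cliques s B E \<subseteq> cliques s V E"
      using AB by (auto simp: cliques_def)
  qed
  moreover have "cliques s A E \<inter> cliques s B E = {C. C \<subseteq> {u, w} \<and> card C = s}"
  proof
    show "cliques s A E \<inter> cliques s B E \<subseteq> {C. C \<subseteq> {u, w} \<and> card C = s}"
      using AB by (auto simp: cliques_def)
    have "(x, y) \<in> E" if "x \<in> {u, w}" "y \<in> {u, w}" "x \<noteq> y" for x y
      using that uw sym by (auto dest: symD)
    then show "{C. C \<subseteq> {u, w} \<and> card C = s} \<subseteq> cliques s A E \<inter> cliques s B E"
      using AB unfolding cliques_def by blast
  qed
  moreover have "card {C. C \<subseteq> {u, w} \<and> card C = s} = 2 choose s"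
    using n_subsets[of "{u, w}" s] ne by (simp add: numeral_2_eq_2)
  moreover have "finite (cliques s A E)" "finite (cliques s B E)"
    using fin AB by (auto simp: cliques_def)
  ultimately show ?thesis using card_Un_Int[of "cliques s A E" "cliques s B E"] by simp
qed

definition no_long_path :: "nat \<Rightarrow> ('a \<times> 'a) set \<Rightarrow> 'a \<Rightarrow> 'a \<Rightarrow> bool" where
  "no_long_path k E u v \<longleftrightarrow> (\<forall>p. path_between E u p v \<longrightarrow> length p < k)"

lemma no_long_path_anti: "no_long_path k E u v \<Longrightarrow> E' \<subseteq> E \<Longrightarrow> no_long_path k E' u v"
  unfolding no_long_path_def by (meson path_between_mono subsetD)

lemma no_long_path_swap: "sym E \<Longrightarrow> no_long_path k E u v \<Longrightarrow> no_long_path k E v u"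
  unfolding no_long_path_def by (metis path_between_rev length_rev)

text \<open>
  The side A is a component of the graph without u and w that does not contain v, together with u
  and w. Long paths from u to w in A are excluded because they extend to v through B without u,
  which is connected.
\<close>
lemma edge_cut_split:
  assumes G: "simple_graph V E" "biconnected V E" and uv: "(u, v) \<in> E" and uw: "(u, w) \<in> E"
    and cut: "\<not> conn_on (V - {u, w}) E" and short: "no_long_path k E u v"
  obtains A B where "A \<union> B = V" "A \<inter> B = {u, w}" "card A < card V" "card B < card V" "v \<in> B"
    "\<And>p q. (p, q) \<in> E \<Longrightarrow> p \<in> A - {u, w} \<Longrightarrow> q \<in> A"
    "biconnected A (E \<inter> A \<times> A)" "biconnected B (E \<inter> B \<times> B)"
    "no_long_path k (E \<inter> A \<times> A) u w" "no_long_path k (E \<inter> B \<times> B) u v"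
proof -
  define U where "U = V - {u, w}"
  define R where "R = E \<inter> U \<times> U"
  have sym: "sym E" and fin: "finite V" and EV: "E \<subseteq> V \<times> V" and ne: "u \<noteq> w" "u \<noteq> v"
    using G uw uv by (auto simp: simple_graph_def irrefl_def)
  have V: "u \<in> V" "v \<in> V" "w \<in> V" using EV uv uw by auto
  have symR: "sym (R\<^sup>*)" using sym by (intro sym_rtrancl) (auto simp: R_def sym_def)
  have inU: "y \<in> U" if "(x, y) \<in> R\<^sup>*" "x \<in> U" for x y
    using that by (induction rule: rtrancl_induct) (auto simp: R_def)
  \<comment> \<open>Two vertices in different components; at least one of these components avoids v.\<close>
  obtain z0 z1 where z01: "z0 \<in> U" "z1 \<in> U" "(z0, z1) \<notin> R\<^sup>*"
    using cut by (auto simp: conn_on_def R_def U_def)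
  then have "(z0, v) \<notin> R\<^sup>* \<or> (z1, v) \<notin> R\<^sup>*" using symR by (meson rtrancl_trans symD)
  then obtain z z' where z: "z \<in> U" "z' \<in> U" "(z, z') \<notin> R\<^sup>*" "(z, v) \<notin> R\<^sup>*"
    using z01 symR by (metis symD)
  define D where "D = {y. (z, y) \<in> R\<^sup>*}"
  have D: "D \<subseteq> U" "z \<in> D" "z' \<notin> D" "v \<notin> D" using z inU by (auto simp: D_def)
  define A where "A = D \<union> {u, w}"
  define B where "B = V - D"
  have AB: "A \<union> B = V" "A \<inter> B = {u, w}" and Auw: "A - {u, w} = D" and vB: "v \<in> B"
    using D V by (auto simp: A_def B_def U_def)
  have closed: "q \<in> A" if "(p, q) \<in> E" "p \<in> A - {u, w}" for p q
  proof (cases "q \<in> {u, w}")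
    case False
    then have "(p, q) \<in> R" using that D EV Auw by (auto simp: R_def U_def)
    then show ?thesis using that Auw by (auto simp: D_def A_def intro: rtrancl_into_rtrancl)
  qed (auto simp: A_def)
  have closedB: "q \<in> B" if "(p, q) \<in> E" "p \<in> B - {u, w}" for p q
  proof (rule ccontr)
    assume "q \<notin> B"
    then have "q \<in> A - {u, w}" using that EV Auw by (auto simp: B_def)
    then have "p \<in> A" using closed[of q p] that sym by (auto dest: symD)
    then show False using that AB by auto
  qed
  have zA: "z \<in> A - {u, w}" and zB: "z' \<in> B - {u, w}"
    using D z Auw by (auto simp: B_def U_def)
  have bA: "biconnected A (E \<inter> A \<times> A)"
    by (rule biconnected_side[OF G uw _ _ _ zA closed]) (use AB in auto)
  have bB: "biconnected B (E \<inter> B \<times> B)"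
    by (rule biconnected_side[OF G uw _ _ _ zB closedB]) (use AB in auto)
  have "A \<subset> V" using zB AB by blast
  then have cA: "card A < card V" using fin by (simp add: psubset_card_mono)
  have "B \<subset> V" using zA AB by blast
  then have cB: "card B < card V" using fin by (simp add: psubset_card_mono)
  have sA: "no_long_path k (E \<inter> A \<times> A) u w"
  proof (cases "w = v")
    case True
    then show ?thesis using short by (auto intro: no_long_path_anti)
  next
    case False
    have "conn_on (B - {u}) (E \<inter> B \<times> B)" using bB AB by (auto simp: biconnected_def)
    then have "(w, v) \<in> ((E \<inter> B \<times> B) \<inter> (B - {u}) \<times> (B - {u}))\<^sup>*"
      using vB AB ne by (auto simp: conn_on_def)
    then obtain q where q: "path_between (E \<inter> B \<times> B) w q v" "set q \<subseteq> B - {u}"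
      using path_of_reachable[of w v "E \<inter> B \<times> B" "B - {u}"] AB ne by blast
    then obtain q' where q': "q = w # q'" by (cases q) (auto simp: path_between_def)
    with q False have "q' \<noteq> []" by (auto simp: path_between_def)
    show ?thesis
      unfolding no_long_path_def
    proof (intro allI impI)
      fix p assume p: "path_between (E \<inter> A \<times> A) u p w"
      have pA: "set p \<subseteq> A" by (rule path_subset[OF p]) (auto simp: A_def)
      have pE: "path_between E u p w" using p by (rule path_between_mono) auto
      have qE: "path_between E w q v" using q(1) by (rule path_between_mono) auto
      have "set q' \<inter> {u, w} = {}" "set q' \<subseteq> B" using q q' qE by (auto simp: path_between_def)
      then have "set p \<inter> set q' = {}" using pA AB by blast
      then have "path_between E u (p @ q') v"
        using pE qE q' \<open>q' \<noteq> []\<close>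
        by (auto simp: path_between_def successively_append_iff successively_Cons)
      then have "length (p @ q') < k" using short unfolding no_long_path_def by blast
      then show "length p < k" by simp
    qed
  qed
  have sB: "no_long_path k (E \<inter> B \<times> B) u v"
    using short by (rule no_long_path_anti) auto
  show ?thesis by (rule that[OF AB cA cB vB closed bA bB sA sB])
qed

section \<open>Long cycles by closing a path, and deletion of vertices of small degree\<close>

text \<open>
  Two adjacent vertices also form such a list; the lengths that matter are at least k - 1, hence
  at least 3.
\<close>
definition cycle_list :: "('a \<times> 'a) set \<Rightarrow> 'a list \<Rightarrow> bool" where
  "cycle_list E c \<longleftrightarrow>
     c \<noteq> [] \<and> distinct c \<and> successively (\<lambda>x y. (x, y) \<in> E) c \<and> (last c, hd c) \<in> E"

lemma card_nbrs_on_list: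
  assumes "distinct p"
  shows "card {z \<in> set p. (x, z) \<in> E} = card {l. l < length p \<and> (x, p ! l) \<in> E}"
proof -
  have "{z \<in> set p. (x, z) \<in> E} = (!) p ` {l. l < length p \<and> (x, p ! l) \<in> E}"
    by (auto simp: in_set_conv_nth)
  moreover have "inj_on ((!) p) {l. l < length p \<and> (x, p ! l) \<in> E}"
    using assms by (intro inj_on_nth) auto
  ultimately show ?thesis by (simp add: card_image)
qed

text \<open>
  Kopylov's version of Posa's closing argument. Two common neighbours of the ends yield positions
  i < j such that y is adjacent to the i-th and x to the j-th vertex. Choose such a pair with j - i
  minimal. The path up to i followed by the reversed path from j on is a cycle that misses only
  the vertices strictly between them, and by minimality neither end has a neighbour there. Shifting
  the positions of the neighbours of y by one makes them disjoint from those of the neighbours of x,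
  unless the cycle contains the whole path; this bounds the degree sum by the length of the cycle.
\<close>
lemma crossing_cycle:
  assumes sym: "sym E" and irrefl: "irrefl E" and p: "path_between E x p y"
    and ab: "a \<in> set p" "b \<in> set p" "a \<noteq> b"
    and adj: "(x, a) \<in> E" "(x, b) \<in> E" "(y, a) \<in> E" "(y, b) \<in> E"
  shows "\<exists>c. cycle_list E c \<and> set c \<subseteq> set p \<and>
    min (length p) (card {z \<in> set p. (x, z) \<in> E} + card {z \<in> set p. (y, z) \<in> E}) \<le> length c"
proof -
  define n where "n = length p"
  define S where "S = {l. l < n \<and> (x, p ! l) \<in> E}"
  define T where "T = {l. l < n \<and> (y, p ! l) \<in> E}"
  define P where "P = (\<lambda>ij. fst ij < snd ij \<and> fst ij \<in> T \<and> snd ij \<in> S)"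
  have pp: "p \<noteq> []" "hd p = x" "last p = y" "distinct p" "successively (\<lambda>x y. (x, y) \<in> E) p"
    using p by (auto simp: path_between_def)
  have n: "0 < n" using pp by (simp add: n_def)
  have p0: "p ! 0 = x" and pn: "p ! (n - 1) = y"
    using pp by (auto simp: hd_conv_nth last_conv_nth n_def)
  obtain i0 j0 where i0: "i0 < n" "p ! i0 = a" and j0: "j0 < n" "p ! j0 = b"
    using ab by (auto simp: in_set_conv_nth n_def)
  then have "i0 < j0 \<or> j0 < i0" using ab(3) i0(2) j0(2) by (metis linorder_neqE_nat)
  then have "P (i0, j0) \<or> P (j0, i0)"
    using i0 j0 adj by (auto simp: P_def S_def T_def)
  then obtain ij where ij: "P ij" "\<And>kl. P kl \<Longrightarrow> snd ij - fst ij \<le> snd kl - fst kl"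
    using ex_has_least_nat[of P _ "\<lambda>kl. snd kl - fst kl"] by metis
  obtain i j where "ij = (i, j)" by fastforce
  with ij have i: "i < j" "i \<in> T" "j \<in> S"
    and least: "\<And>k l. k < l \<Longrightarrow> k \<in> T \<Longrightarrow> l \<in> S \<Longrightarrow> j - i \<le> l - k"
    by (auto simp: P_def)
  have jn: "j < n" "i < n" using i by (auto simp: S_def)
  define c where "c = take (Suc i) p @ rev (drop j p)"
  have ne: "take (Suc i) p \<noteq> []" "drop j p \<noteq> []" using pp jn by (auto simp: n_def)
  have lasti: "last (take (Suc i) p) = p ! i" using jn by (simp add: n_def take_Suc_conv_app_nth)
  have hdj: "hd (drop j p) = p ! j" using jn by (simp add: n_def hd_drop_conv_nth)
  have split: "p = take (Suc i) p @ drop (Suc i) p" "p = take j p @ drop j p" by simp_all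
  have sub1: "successively (\<lambda>x y. (x, y) \<in> E) (take (Suc i) p)"
    using pp(5) split(1) by (metis successively_append_iff)
  have "successively (\<lambda>x y. (x, y) \<in> E) (drop j p)"
    using pp(5) split(2) by (metis successively_append_iff)
  then have sub2: "successively (\<lambda>x y. (y, x) \<in> E) (drop j p)"
    using sym by (auto elim!: successively_mono dest: symD)
  have "set (take (Suc i) p) \<inter> set (drop j p) = {}"
    using set_take_disj_set_drop_if_distinct[of p "Suc i" j] pp(4) i(1) by simp
  then have "cycle_list E c"
    using pp ne sub1 sub2 i lasti hdj sym
    by (auto simp: cycle_list_def c_def successively_append_iff hd_rev last_rev S_def T_def hd_append
        last_drop n_def dest: symD)
  moreover have "set c \<subseteq> set p" by (auto simp: c_def dest: in_set_takeD in_set_dropD)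
  moreover have "length c = i + 1 + (n - j)" using jn by (simp add: c_def n_def)
  moreover have "min n (card S + card T) \<le> i + 1 + (n - j)"
  proof (cases "j = i + 1")
    case True
    then show ?thesis using jn by simp
  next
    case False
    then have gap: "i + 1 < j" using i by simp
    have fin: "finite S" "finite T" by (auto simp: S_def T_def)
    have disj: "S \<inter> Suc ` T = {}"
    proof (rule ccontr)
      assume "\<not> ?thesis"
      then obtain l where "l \<in> T" "Suc l \<in> S" by blast
      then show False using least[of l "Suc l"] gap by simp
    qed
    have "l \<in> {1..i + 1} \<union> {j..<n}" if "l \<in> S" for l
    proof -
      have "l \<noteq> 0" "l < n" using that p0 irrefl by (auto simp: S_def irrefl_def intro: ccontr)
      moreover have "l \<le> i \<or> j \<le> l" using least[of i l] that i by force
      ultimately show ?thesis by auto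
    qed
    moreover have "Suc l \<in> {1..i + 1} \<union> {j..<n}" if "l \<in> T" for l
    proof -
      have "l \<noteq> n - 1" "l < n" using that pn irrefl by (auto simp: T_def irrefl_def)
      moreover have "l \<le> i \<or> j \<le> l" using least[of l j] that i by force
      ultimately show ?thesis by auto
    qed
    ultimately have "S \<union> Suc ` T \<subseteq> {1..i + 1} \<union> {j..<n}" by blast
    then have "card (S \<union> Suc ` T) \<le> card ({1..i + 1} \<union> {j..<n})" by (intro card_mono) auto
    also have "\<dots> \<le> (i + 1) + (n - j)" using card_Un_le[of "{1..i + 1}" "{j..<n}"] by simp
    finally have "card S + card T \<le> (i + 1) + (n - j)"
      using disj fin by (simp add: card_Un_disjoint card_image)
    then show ?thesis by simp
  qed
  moreover have "card {z \<in> set p. (x, z) \<in> E} = card S" "card {z \<in> set p. (y, z) \<in> E} = card T"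
    unfolding S_def T_def n_def by (rule card_nbrs_on_list[OF pp(4)])+
  ultimately show ?thesis by (intro exI[of _ c]) (simp add: n_def)
qed

text \<open>
  Take a longest path between nonadjacent vertices x \<in> X and y \<in> Y. A neighbour z \<in> X of x outside the
  path would either be adjacent to y and close a long cycle, or be nonadjacent to y and give a longer
  path of the same kind; similarly for y. So the degrees of x and y in X and Y are attained on
  the path, and closing it gives a cycle of length at least l. The dominating vertices a and b are
  the common neighbours needed for that.
\<close>
lemma no_nonadjacent_pair:
  assumes sym: "sym E" and irrefl: "irrefl E" and fin: "finite W"
    and X: "X \<subseteq> W" "a \<in> X" "b \<in> X" and Y: "Y \<subseteq> W" "a \<in> Y" "b \<in> Y" and "a \<noteq> b"
    and dom: "\<And>z. z \<in> W \<Longrightarrow> z \<noteq> a \<Longrightarrow> (a, z) \<in> E" "\<And>z. z \<in> W \<Longrightarrow> z \<noteq> b \<Longrightarrow> (b, z) \<in> E"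
    and short: "\<And>c. cycle_list E c \<Longrightarrow> set c \<subseteq> W \<Longrightarrow> length c < l"
    and long: "\<And>x y. x \<in> X \<Longrightarrow> y \<in> Y \<Longrightarrow> x \<noteq> y \<Longrightarrow> (x, y) \<notin> E \<Longrightarrow>
      \<exists>p. path_between E x p y \<and> set p \<subseteq> W \<and> l \<le> length p"
    and deg: "\<And>x y. x \<in> X \<Longrightarrow> y \<in> Y \<Longrightarrow> x \<noteq> y \<Longrightarrow> (x, y) \<notin> E \<Longrightarrow>
      l \<le> card {z \<in> X. (x, z) \<in> E} + card {z \<in> Y. (y, z) \<in> E}"
    and xy: "x0 \<in> X" "y0 \<in> Y" "x0 \<noteq> y0"
  shows "(x0, y0) \<in> E"
proof (rule ccontr)
  assume non: "(x0, y0) \<notin> E"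
  define Q where "Q p \<longleftrightarrow> hd p \<in> X \<and> last p \<in> Y \<and> hd p \<noteq> last p \<and> (hd p, last p) \<notin> E \<and>
    path_between E (hd p) p (last p) \<and> set p \<subseteq> W" for p
  have "\<exists>p. Q p" using long[OF xy non] xy non by (auto simp: Q_def path_between_def)
  moreover have "\<forall>p. Q p \<longrightarrow> length p \<le> card W"
    using fin by (auto simp: Q_def path_between_def) (metis card_mono distinct_card)
  then have "\<forall>p. Q p \<longrightarrow> length p < Suc (card W)" by (simp add: less_Suc_eq_le)
  ultimately obtain p where p: "Q p" and greatest: "\<And>q. Q q \<Longrightarrow> length q \<le> length p"
    using ex_has_greatest_nat[of Q _ length "Suc (card W)"] by blast
  define x y where "x = hd p" and "y = last p"
  have xy': "x \<in> X" "y \<in> Y" "x \<noteq> y" "(x, y) \<notin> E" "path_between E x p y" "set p \<subseteq> W"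
    using p by (auto simp: Q_def x_def y_def)
  have pl: "l \<le> length p"
  proof -
    obtain q where "path_between E x q y" "set q \<subseteq> W" "l \<le> length q"
      using long[OF xy'(1-4)] by blast
    moreover from this have "Q q" using xy' by (auto simp: Q_def path_between_def)
    ultimately show ?thesis using greatest by force
  qed
  have pp: "p \<noteq> []" "hd p = x" "last p = y" "distinct p" "successively (\<lambda>x y. (x, y) \<in> E) p" "y \<in> set p" "x \<in> set p"
    using xy'(5) by (auto simp: path_between_def)
  have x_nbrs: "z \<in> set p" if z: "z \<in> X" "(x, z) \<in> E" for z
  proof (rule ccontr)
    assume out: "z \<notin> set p"
    have zx: "(z, x) \<in> E" using z sym by (auto dest: symD)
    have path: "path_between E z (z # p) y" "set (z # p) \<subseteq> W"
      using pp out zx z xy'(6) X by (auto simp: path_between_def successively_Cons)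
    show False
    proof (cases "(y, z) \<in> E")
      case True
      then have "cycle_list E (z # p)" using path pp by (auto simp: path_between_def cycle_list_def)
      then show False using short[OF _ path(2)] pl by fastforce
    next
      case False
      then have "(z, y) \<notin> E" using sym by (auto dest: symD)
      then have "Q (z # p)" using path z xy' pp out by (auto simp: Q_def)
      then show False using greatest by fastforce
    qed
  qed
  have y_nbrs: "z \<in> set p" if z: "z \<in> Y" "(y, z) \<in> E" for z
  proof (rule ccontr)
    assume out: "z \<notin> set p"
    have path: "path_between E x (p @ [z]) z" "set (p @ [z]) \<subseteq> W"
      using pp out z xy'(6) Y by (auto simp: path_between_def successively_append_iff)
    show False
    proof (cases "(z, x) \<in> E")
      case True
      then have "cycle_list E (p @ [z])" using path pp by (auto simp: path_between_def cycle_list_def)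
      then show False using short[OF _ path(2)] pl by fastforce
    next
      case False
      then have "(x, z) \<notin> E" using sym by (auto dest: symD)
      then have "Q (p @ [z])" using path z xy' pp out by (auto simp: Q_def)
      then show False using greatest by fastforce
    qed
  qed
  have XYW: "x \<in> W" "y \<in> W" using xy' X Y by auto
  have "x \<noteq> a" "x \<noteq> b" using dom XYW xy' by blast+
  moreover have "y \<noteq> a" "y \<noteq> b" using dom XYW xy' sym by (metis symD)+
  ultimately have adj: "(x, a) \<in> E" "(x, b) \<in> E" "(y, a) \<in> E" "(y, b) \<in> E"
    using dom XYW sym by (metis symD)+
  have "a \<in> set p" "b \<in> set p" using x_nbrs X adj by auto
  then obtain c where c: "cycle_list E c" "set c \<subseteq> set p"
    "min (length p) (card {z \<in> set p. (x, z) \<in> E} + card {z \<in> set p. (y, z) \<in> E}) \<le> length c"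
    using crossing_cycle[OF sym irrefl xy'(5) _ _ \<open>a \<noteq> b\<close> adj] by blast
  have "card {z \<in> X. (x, z) \<in> E} \<le> card {z \<in> set p. (x, z) \<in> E}"
    by (intro card_mono) (use x_nbrs in auto)
  moreover have "card {z \<in> Y. (y, z) \<in> E} \<le> card {z \<in> set p. (y, z) \<in> E}"
    by (intro card_mono) (use y_nbrs in auto)
  ultimately have "l \<le> card {z \<in> set p. (x, z) \<in> E} + card {z \<in> set p. (y, z) \<in> E}"
    using deg[OF xy'(1-4)] by linarith
  then have "l \<le> length c" using c(3) pl by linarith
  moreover have "length c < l" using short[OF c(1)] c(2) xy'(6) by blast
  ultimately show False by simp
qed

lemma card_cliques_le_choose:
  assumes "finite A"
  shows "card (cliques s A E) \<le> card A choose s"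
proof -
  have "card (cliques s A E) \<le> card {C. C \<subseteq> A \<and> card C = s}"
    using assms by (intro card_mono finite_subset[of "{C. C \<subseteq> A \<and> card C = s}" "Pow A"]) (auto simp: cliques_def)
  then show ?thesis using assms by (simp add: n_subsets)
qed

text \<open>
  The cliques through x correspond to (s-1)-subsets of its neighbourhood.
\<close>
lemma card_cliques_remove:
  assumes "finite V" "0 < s"
  shows "card (cliques s V E) \<le> card (cliques s (V - {x}) E) + (card {z \<in> V. (x, z) \<in> E} choose (s - 1))"
proof -
  define N where "N = {z \<in> V. (x, z) \<in> E}"
  define A where "A = {C \<in> cliques s V E. x \<in> C}"
  have finN: "finite N" using assms by (simp add: N_def)
  have "cliques s V E \<subseteq> cliques s (V - {x}) E \<union> A" by (auto simp: cliques_def A_def)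
  moreover have "finite A" using finite_cliques[OF assms(1)] by (simp add: A_def)
  ultimately have "card (cliques s V E) \<le> card (cliques s (V - {x}) E \<union> A)"
    using assms finite_cliques[of "V - {x}" s E] by (intro card_mono) auto
  also have "\<dots> \<le> card (cliques s (V - {x}) E) + card A" by (rule card_Un_le)
  also have "card A \<le> card {D. D \<subseteq> N \<and> card D = s - 1}"
  proof (rule card_inj_on_le)
    show "inj_on (\<lambda>C. C - {x}) A" by (rule inj_onI) (auto simp: A_def)
    show "(\<lambda>C. C - {x}) ` A \<subseteq> {D. D \<subseteq> N \<and> card D = s - 1}"
      using assms by (auto simp: A_def cliques_def N_def card_Diff_singleton dest: finite_subset)
    show "finite {D. D \<subseteq> N \<and> card D = s - 1}"
      using finN by (intro finite_subset[of "{D. D \<subseteq> N \<and> card D = s - 1}" "Pow N"]) auto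
  qed
  finally show ?thesis using finN by (simp add: n_subsets N_def)
qed

text \<open>
  Greedy deletion of vertices outside K with at most a neighbours, stopped when only c vertices
  are left. With c equal to the order of a clique K, the deletion ends in K itself or in a larger
  set where all vertices outside K have many neighbours.
\<close>
lemma remove_low_degree:
  assumes "finite V" "K \<subseteq> V" "c \<le> card V" "0 < s"
  shows "\<exists>L. K \<subseteq> L \<and> L \<subseteq> V \<and> c \<le> card L \<and>
    card (cliques s V E) \<le> card (cliques s L E) + (card V - card L) * (a choose (s - 1)) \<and>
    (card L = c \<or> (\<forall>x\<in>L - K. a < card {z \<in> L. (x, z) \<in> E}))"
  using assms
proof (induction "card V" arbitrary: V)
  case 0
  then show ?case by (intro exI[of _ V]) auto
next
  case (Suc n)
  show ?case
  proof (cases "card V = c \<or> (\<forall>x\<in>V - K. a < card {z \<in> V. (x, z) \<in> E})")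
    case True
    then show ?thesis using Suc.prems by (intro exI[of _ V]) auto
  next
    case False
    then obtain x where x: "x \<in> V" "x \<notin> K" "card {z \<in> V. (x, z) \<in> E} \<le> a" "card V \<noteq> c"
      by (auto simp: not_less)
    have card: "card (V - {x}) = n" using Suc x by simp
    obtain L where L: "K \<subseteq> L" "L \<subseteq> V - {x}" "c \<le> card L"
      "card (cliques s (V - {x}) E) \<le> card (cliques s L E) + (n - card L) * (a choose (s - 1))"
      "card L = c \<or> (\<forall>x\<in>L - K. a < card {z \<in> L. (x, z) \<in> E})"
      using Suc.hyps(1)[of "V - {x}"] Suc.prems Suc.hyps(2) card x by auto
    have "card L \<le> n" using L(2) card Suc.prems(1) by (metis card_mono finite_Diff)
    have "card (cliques s V E) \<le> card (cliques s (V - {x}) E) + (card {z \<in> V. (x, z) \<in> E} choose (s - 1))"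
      by (rule card_cliques_remove[OF Suc.prems(1,4)])
    also have "\<dots> \<le> card (cliques s L E) + (n - card L) * (a choose (s - 1)) + (a choose (s - 1))"
      using L(4) binomial_right_mono[OF x(3)] by (intro add_mono) auto
    also have "\<dots> = card (cliques s L E) + (card V - card L) * (a choose (s - 1))"
    proof -
      have "card V - card L = Suc (n - card L)"
        using \<open>card L \<le> n\<close> Suc.hyps(2)[symmetric] by (simp add: Suc_diff_le)
      then show ?thesis by simp
    qed
    finally show ?thesis using L by (intro exI[of _ L]) auto
  qed
qed

section \<open>Saturated graphs with three dominating vertices\<close>

definition is_clique :: "('a \<times> 'a) set \<Rightarrow> 'a set \<Rightarrow> bool" where
  "is_clique E C \<longleftrightarrow> (\<forall>x\<in>C. \<forall>y\<in>C. x \<noteq> y \<longrightarrow> (x, y) \<in> E)"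

definition dominating :: "'a set \<Rightarrow> ('a \<times> 'a) set \<Rightarrow> 'a \<Rightarrow> bool" where
  "dominating A E a \<longleftrightarrow> (\<forall>z\<in>A. z \<noteq> a \<longrightarrow> (a, z) \<in> E)"

lemma not_successively_split:
  "\<not> successively P p \<Longrightarrow> \<exists>as c d bs. p = as @ c # d # bs \<and> \<not> P c d"
proof (induction p)
  case (Cons x p)
  then have "p \<noteq> []" by auto
  then obtain y q where p: "p = y # q" by (cases p) auto
  show ?case
  proof (cases "P x y")
    case False
    then show ?thesis using p by (intro exI[of _ "[]"]) auto
  next
    case True
    then obtain as c d bs where "p = as @ c # d # bs \<and> \<not> P c d" using Cons p by auto
    then show ?thesis by (intro exI[of _ "x # as"]) auto
  qed
qed simp

lemma clique_path:
  assumes "is_clique E C" "finite C" "u \<in> C" "v \<in> C" "u \<noteq> v"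
  shows "\<exists>p. path_between E u p v \<and> length p = card C"
proof -
  obtain xs where xs: "set xs = C - {u, v}" "distinct xs"
    using finite_distinct_list[of "C - {u, v}"] assms by auto
  \<comment> \<open>List the clique in any order that starts with u and ends with v.\<close>
  define p where "p = u # xs @ [v]"
  have p: "distinct p" "set p = C" using xs assms by (auto simp: p_def)
  have "successively (\<lambda>x y. (x, y) \<in> E) q" if "distinct q" "set q \<subseteq> C" for q
    using that
  proof (induction q)
    case (Cons x q)
    have "q \<noteq> [] \<Longrightarrow> (x, hd q) \<in> E"
      using Cons.prems hd_in_set[of q] assms(1) unfolding is_clique_def
      by (metis distinct.simps(2) in_mono list.set_intros)
    then show ?case using Cons by (cases "q = []") (simp_all add: successively_Cons)
  qed simp
  then have "path_between E u p v" using p by (simp add: path_between_def p_def)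
  then show ?thesis using p distinct_card by metis
qed

text \<open>
  A cycle that avoids v is opened at u, or entered from u at any vertex, and then continued to
  the dominating vertex v.
\<close>
lemma cycle_through_dominating:
  assumes "sym E" and c: "cycle_list E c" "v \<notin> set c" "set c \<subseteq> V" and "u \<in> V" "u \<noteq> v" "v \<in> V"
    and dom: "dominating V E u" "dominating V E v"
  shows "\<exists>p. path_between E u p v \<and> length c < length p"
proof -
  have cc: "c \<noteq> []" "distinct c" "successively (\<lambda>x y. (x, y) \<in> E) c" "(last c, hd c) \<in> E"
    using c(1) by (simp_all add: cycle_list_def)
  have tov: "(z, v) \<in> E" if "z \<in> set c" for z
    using that c dom(2) assms(1) by (auto simp: dominating_def dest: symD)
  show ?thesis
  proof (cases "u \<in> set c")
    case True
    then obtain ys zs where ys: "c = ys @ u # zs" by (meson split_list)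
    define p where "p = u # zs @ ys"
    have "successively (\<lambda>x y. (x, y) \<in> E) p"
      using cc by (cases "ys = []"; cases "zs = []")
        (auto simp: p_def ys successively_append_iff successively_Cons hd_append)
    moreover have "distinct p" "set p = set c" "length p = length c" "p \<noteq> []"
      using cc by (auto simp: p_def ys)
    moreover from this have "(last p, v) \<in> E" using tov last_in_set[of p] by auto
    moreover have "hd p = u" by (simp add: p_def)
    ultimately have "path_between E u (p @ [v]) v"
      using c(2) by (simp add: path_between_def successively_append_iff)
    then show ?thesis using \<open>length p = length c\<close> by (intro exI[of _ "p @ [v]"]) simp
  next
    case False
    have "(u, hd c) \<in> E" using dom(1) hd_in_set[OF cc(1)] False c by (auto simp: dominating_def)
    then have "path_between E u (u # c @ [v]) v"
      using cc c(2) False tov assms(6)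
      by (auto simp: path_between_def successively_append_iff successively_Cons)
    then show ?thesis by (intro exI conjI) auto
  qed
qed

text \<open>
  A long u-v path that uses the new edge xy consists of two disjoint parts, one from u to an end of
  xy and one from the other end of xy to v. Discard v and join the loose ends of the two parts
  through the dominating vertex u instead.
\<close>
lemma path_avoiding_end:
  assumes sym: "sym E" and EV: "E \<subseteq> V \<times> V" and x: "x \<in> V" "y \<in> V" "x \<noteq> y" "(x, y) \<notin> E"
    and uv: "u \<in> V" "v \<in> V" "u \<noteq> v"
    and dom: "dominating V E u" "dominating V E v"
    and short: "no_long_path k E u v"
    and p: "path_between (E \<union> {(x, y), (y, x)}) u p v" "k \<le> length p"
  shows "\<exists>q. path_between E x q y \<and> set q \<subseteq> V - {v} \<and> k - 1 \<le> length q"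
proof -
  have non: "x \<notin> {u, v}" "y \<notin> {u, v}" using x dom sym by (auto simp: dominating_def dest: symD)
  have pp: "hd p = u" "last p = v" "distinct p" "successively (\<lambda>a b. (a, b) \<in> E \<union> {(x, y), (y, x)}) p"
    using p by (auto simp: path_between_def)
  have pV: "set p \<subseteq> V" by (rule path_subset[OF p(1)]) (use EV x uv in auto)
  have "\<not> successively (\<lambda>a b. (a, b) \<in> E) p"
    using p short by (auto simp: no_long_path_def path_between_def)
  then obtain as c d bs where split: "p = as @ c # d # bs" "(c, d) \<notin> E"
    using not_successively_split[of "\<lambda>a b. (a, b) \<in> E" p] by blast
  have cd: "(c = x \<and> d = y) \<or> (c = y \<and> d = x)"
    using pp(4) split by (auto simp: successively_append_iff successively_Cons)
  have sub: "successively (\<lambda>a b. (a, b) \<in> E) r"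
    if "successively (\<lambda>a b. (a, b) \<in> E \<union> {(x, y), (y, x)}) r" "x \<notin> set r \<or> y \<notin> set r" for r
    using that(1) by (rule successively_mono) (use that(2) in auto)
  have "successively (\<lambda>a b. (a, b) \<in> E \<union> {(x, y), (y, x)}) (as @ [c])"
      "successively (\<lambda>a b. (a, b) \<in> E \<union> {(x, y), (y, x)}) (d # bs)"
    using pp(4) split(1) by (auto simp: successively_append_iff successively_Cons)
  moreover have "x \<notin> set (as @ [c]) \<or> y \<notin> set (as @ [c])" "x \<notin> set (d # bs) \<or> y \<notin> set (d # bs)"
    using pp(3) split(1) cd by auto
  ultimately have parts: "successively (\<lambda>a b. (a, b) \<in> E) (as @ [c])" "successively (\<lambda>a b. (a, b) \<in> E) (d # bs)"
    using sub by blast+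
  have "as \<noteq> []" "bs \<noteq> []" using pp(1,2) split(1) cd non by auto
  then obtain as' bs' where ab: "as = u # as'" "bs = bs' @ [v]"
    using pp(1,2) split(1) by (metis append_butlast_last_id append_is_Nil_conv hd_append2 last_ConsR last_append list.collapse list.distinct(1))
  \<comment> \<open>The two parts of the path, without their ends u and v and both reversed.\<close>
  define q1 where "q1 = rev (as' @ [c])"
  define q2 where "q2 = rev (d # bs')"
  have "successively (\<lambda>a b. (a, b) \<in> E) (as' @ [c])" "successively (\<lambda>a b. (a, b) \<in> E) (d # bs')"
    using parts ab by (cases "as' = []"; cases "bs' = []"; simp add: successively_Cons successively_append_iff)+
  then have "successively (\<lambda>a b. (b, a) \<in> E) (as' @ [c])" "successively (\<lambda>a b. (b, a) \<in> E) (d # bs')"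
    using sym by (auto elim!: successively_mono dest: symD)
  then have q12: "successively (\<lambda>a b. (a, b) \<in> E) q1" "successively (\<lambda>a b. (a, b) \<in> E) q2"
    unfolding q1_def q2_def successively_rev by simp_all
  have dis: "distinct (q1 @ [u] @ q2)" "set (q1 @ [u] @ q2) \<subseteq> V - {v}"
    using pp(3) split(1) ab pV by (auto simp: q1_def q2_def)
  have ends: "q1 \<noteq> []" "q2 \<noteq> []" "hd q1 = c" "last q2 = d" by (auto simp: q1_def q2_def hd_append)
  have "set q1 \<subseteq> V - {u}" "set q2 \<subseteq> V - {u}" using dis by auto
  then have "last q1 \<in> V - {u}" "hd q2 \<in> V - {u}"
    using last_in_set[OF ends(1)] hd_in_set[OF ends(2)] by blast+
  then have "(last q1, u) \<in> E" "(u, hd q2) \<in> E"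
    using dom(1) sym by (auto simp: dominating_def dest: symD)
  then have path: "path_between E c (q1 @ [u] @ q2) d"
    using q12 dis ends by (auto simp: path_between_def successively_append_iff successively_Cons)
  have len: "k - 1 \<le> length (q1 @ [u] @ q2)" using p(2) by (simp add: split(1) ab q1_def q2_def)
  show ?thesis
  proof (cases "c = x")
    case True
    then show ?thesis using path dis len cd x by (intro exI[of _ "q1 @ [u] @ q2"]) auto
  next
    case False
    then have "path_between E x (rev (q1 @ [u] @ q2)) y"
      using path cd path_between_rev[OF sym] by blast
    then show ?thesis using dis len by (intro exI[of _ "rev (q1 @ [u] @ q2)"]) auto
  qed
qed

text \<open>
  Kopylov's two-step disintegration. The first deletion, with degrees at most d + 2, either reaches
  m - d + 2 vertices, or it stops at a set whose degrees are so large that it is a clique.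
  In the latter case let K be a maximum clique, of order c. The second deletion, with the
  complementary threshold b + 2 where b + c = m + 2, stops at K: otherwise a remaining vertex outside K
  has a nonneighbour in K, and the degree sum of this pair reaches m + 2 = k - 1.
\<close>
lemma saturated_dominated_bound:
  assumes k: "4 \<le> k" and s: "2 \<le> s" and G: "simple_graph V E"
    and distinct: "u \<in> V" "v \<in> V" "a \<in> V" "u \<noteq> v" "a \<noteq> u" "a \<noteq> v"
    and dom: "dominating V E u" "dominating V E v" "dominating V E a"
    and short: "no_long_path k E u v" and large: "k \<le> card V"
    and saturated: "\<And>x y. x \<in> V \<Longrightarrow> y \<in> V \<Longrightarrow> x \<noteq> y \<Longrightarrow> (x, y) \<notin> E \<Longrightarrow>
      \<exists>p. path_between (E \<union> {(x, y), (y, x)}) u p v \<and> k \<le> length p"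
  shows "card (cliques s V E) \<le> (2 choose s) + block_sum (wt s) (k - 3) (card V - 2)"
proof -
  have sym: "sym E" and irrefl: "irrefl E" and fin: "finite V" and EV: "E \<subseteq> V \<times> V"
    using G by (auto simp: simple_graph_def)
  define m where "m = k - 3"
  define N where "N = card V - 2"
  define d where "d = (m - 1) div 2"
  have m: "1 \<le> m" "k = m + 3" "m \<le> N" "card V = N + 2" using k large by (auto simp: m_def N_def)
  have d: "2 * d + 1 \<le> m" "m \<le> 2 * d + 2" using m(1) by (auto simp: d_def)
  have no_cycle: "length c < k - 1" if c: "cycle_list E c" "set c \<subseteq> V - {v}" for c
  proof -
    obtain p where "path_between E u p v" "length c < length p"
      using cycle_through_dominating[OF sym c(1) _ _ _ _ _ dom(1,2)] c(2) distinct by blast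
    then show ?thesis using short by (fastforce simp: no_long_path_def)
  qed
  have pair: "(x, y) \<in> E"
    if X: "X \<subseteq> V" "u \<in> X" "a \<in> X" and Y: "Y \<subseteq> V" "u \<in> Y" "a \<in> Y"
      and deg: "\<And>x y. x \<in> X - {v} \<Longrightarrow> y \<in> Y - {v} \<Longrightarrow> x \<noteq> y \<Longrightarrow> (x, y) \<notin> E \<Longrightarrow>
         k - 1 \<le> card {z \<in> X - {v}. (x, z) \<in> E} + card {z \<in> Y - {v}. (y, z) \<in> E}"
      and xy: "x \<in> X - {v}" "y \<in> Y - {v}" "x \<noteq> y" for X Y x y
  proof (rule no_nonadjacent_pair[OF sym irrefl, of "V - {v}" "X - {v}" u a "Y - {v}" "k - 1" x y])
    show "\<exists>p. path_between E x p y \<and> set p \<subseteq> V - {v} \<and> k - 1 \<le> length p"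
      if xy': "x \<in> X - {v}" "y \<in> Y - {v}" "x \<noteq> y" "(x, y) \<notin> E" for x y
    proof -
      have V: "x \<in> V" "y \<in> V" using xy' X Y by auto
      obtain p where "path_between (E \<union> {(x, y), (y, x)}) u p v" "k \<le> length p"
        using saturated[OF V xy'(3,4)] by blast
      then show ?thesis
        using path_avoiding_end[OF sym EV V xy'(3,4) distinct(1,2,4) dom(1,2) short] by blast
    qed
  qed (use fin X Y distinct dom no_cycle deg xy in \<open>auto simp: dominating_def\<close>)
  have drop_v: "card {z \<in> L. (x, z) \<in> E} \<le> Suc (card {z \<in> L - {v}. (x, z) \<in> E})" if "L \<subseteq> V" for L x
  proof -
    have "finite L" using that fin finite_subset by blast
    then have "card {z \<in> L. (x, z) \<in> E} \<le> card (insert v {z \<in> L - {v}. (x, z) \<in> E})"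
      by (intro card_mono) auto
    then show ?thesis using \<open>finite L\<close> by (simp add: card_insert_if)
  qed
  have bound: "card (cliques s V E) \<le> (2 choose s) + block_sum (wt s) m N"
    if "2 * b + 1 \<le> m" "L \<subseteq> V" "card L = m - b + 2"
      "card (cliques s V E) \<le> card (cliques s L E) + (card V - card L) * ((b + 2) choose (s - 1))" for b L
  proof -
    have "card (cliques s L E) \<le> (m - b + 2) choose s"
      using card_cliques_le_choose[of L s E] that fin finite_subset by metis
    moreover have "card V - card L = N - (m - b)" using that(3) m(4) by simp
    ultimately have "card (cliques s V E) \<le> ((m - b + 2) choose s) + (N - (m - b)) * wt s b"
      using that(4) by (simp add: wt_def)
    then show ?thesis using two_level_bound[OF s that(1) m(3)] by simp
  qed
  obtain L where L: "{u, v, a} \<subseteq> L" "L \<subseteq> V" "m - d + 2 \<le> card L"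
    "card (cliques s V E) \<le> card (cliques s L E) + (card V - card L) * ((d + 2) choose (s - 1))"
    "card L = m - d + 2 \<or> (\<forall>x\<in>L - {u, v, a}. d + 2 < card {z \<in> L. (x, z) \<in> E})"
  proof -
    have "{u, v, a} \<subseteq> V" "m - d + 2 \<le> card V" "0 < s" using distinct m s by auto
    from remove_low_degree[OF fin this, of E "d + 2"] show ?thesis using that by blast
  qed
  show ?thesis
  proof (cases "card L = m - d + 2")
    case True
    then show ?thesis using bound[OF d(1) L(2) True L(4)] by (simp add: m_def N_def)
  next
    case False
    then have Ldeg: "d + 2 < card {z \<in> L. (x, z) \<in> E}" if "x \<in> L - {u, v, a}" for x
      using L(5) that by blast
    have "is_clique E L"
      unfolding is_clique_def
    proof (intro ballI impI)
      fix x y assume xy: "x \<in> L" "y \<in> L" "x \<noteq> y"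
      have deg: "d + 2 \<le> card {z \<in> L - {v}. (x', z) \<in> E}"
        if "x' \<in> L - {v}" "y' \<in> L - {v}" "x' \<noteq> y'" "(x', y') \<notin> E" for x' y'
      proof -
        have "x' \<noteq> u" "x' \<noteq> a" using that L(2) dom by (auto simp: dominating_def)
        then show ?thesis using Ldeg[of x'] drop_v[OF L(2), of x'] that by auto
      qed
      show "(x, y) \<in> E"
      proof (cases "x = v \<or> y = v")
        case True
        then show ?thesis using xy L(2) dom(2) sym by (auto simp: dominating_def dest: symD)
      next
        case False
        show ?thesis
        proof (rule pair[of L L])
          fix x' y' assume h: "x' \<in> L - {v}" "y' \<in> L - {v}" "x' \<noteq> y'" "(x', y') \<notin> E"
          then have "(y', x') \<notin> E" using sym by (auto dest: symD)
          then have "d + 2 \<le> card {z \<in> L - {v}. (x', z) \<in> E}" "d + 2 \<le> card {z \<in> L - {v}. (y', z) \<in> E}"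
            using deg[OF h] deg[OF h(2,1) h(3)[symmetric]] by blast+
          then show "k - 1 \<le> card {z \<in> L - {v}. (x', z) \<in> E} + card {z \<in> L - {v}. (y', z) \<in> E}"
            using d m by linarith
        qed (use L(1,2) xy False in auto)
      qed
    qed
    \<comment> \<open>Every clique of order at least that of L serves below; containing L ensures that u, v and a belong to it.\<close>
    define KK where "KK = {K. L \<subseteq> K \<and> K \<subseteq> V \<and> is_clique E K}"
    have "L \<in> KK" using L(2) \<open>is_clique E L\<close> by (simp add: KK_def)
    moreover have "\<forall>K. K \<in> KK \<longrightarrow> card K < Suc (card V)"
      using fin by (auto simp: KK_def less_Suc_eq_le card_mono)
    ultimately obtain K where K: "K \<in> KK" and Kmax: "\<And>K'. K' \<in> KK \<Longrightarrow> card K' \<le> card K"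
      using ex_has_greatest_nat[of "\<lambda>K. K \<in> KK" L card "Suc (card V)"] by blast
    then have K': "L \<subseteq> K" "K \<subseteq> V" "is_clique E K" by (auto simp: KK_def)
    have finK: "finite K" using K'(2) fin finite_subset by blast
    define c where "c = card K"
    have "card L \<le> c" using K'(1) finK by (simp add: c_def card_mono)
    then have c_low: "m - d + 2 < c" using L(3) False by linarith
    have "c < k"
    proof -
      obtain p where "path_between E u p v" "length p = c"
        using clique_path[OF K'(3) finK] L(1) K'(1) distinct unfolding c_def by blast
      then show ?thesis using short by (auto simp: no_long_path_def)
    qed
    then have c_high: "c \<le> m + 2" using m by simp
    define b where "b = m + 2 - c"
    have b: "2 * b + 1 \<le> m" "c = m - b + 2" "b + c = m + 2" using c_low c_high d by (auto simp: b_def)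
    obtain L' where L': "K \<subseteq> L'" "L' \<subseteq> V" "c \<le> card L'"
      "card (cliques s V E) \<le> card (cliques s L' E) + (card V - card L') * ((b + 2) choose (s - 1))"
      "card L' = c \<or> (\<forall>x\<in>L' - K. b + 2 < card {z \<in> L'. (x, z) \<in> E})"
    proof -
      have "c \<le> card V" "0 < s" using c_high m s by auto
      from remove_low_degree[OF fin K'(2) this, of E "b + 2"] show ?thesis using that by blast
    qed
    show ?thesis
    proof (cases "card L' = c")
      case True
      then show ?thesis using bound[OF b(1) L'(2) _ L'(4)] b(2) by (simp add: m_def N_def)
    next
      case False
      then have L'deg: "b + 2 < card {z \<in> L'. (x, z) \<in> E}" if "x \<in> L' - K" for x
        using L'(5) that by blast
      have "K \<noteq> L'" using False by (auto simp: c_def)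
      then obtain x where x: "x \<in> L'" "x \<notin> K" using L'(1) by blast
      \<comment> \<open>A vertex outside the maximum clique K has a nonneighbour in K.\<close>
      have "insert x K \<notin> KK" using Kmax[of "insert x K"] x finK by auto
      then have "\<not> is_clique E (insert x K)" using x K' L'(2) by (auto simp: KK_def)
      then obtain y where y: "y \<in> K" "(x, y) \<notin> E"
        using K'(3) sym x by (auto simp: is_clique_def dest: symD)
      have "y \<noteq> v" using y x L'(2) dom(2) sym K'(1) L(1) by (auto simp: dominating_def dest: symD)
      have "x \<noteq> v" using x K'(1) L(1) by auto
      have "(x, y) \<in> E"
      proof (rule pair[of L' K])
        fix x' y' assume h: "x' \<in> L' - {v}" "y' \<in> K - {v}" "x' \<noteq> y'" "(x', y') \<notin> E"
        then have "x' \<notin> K" using K'(3) by (auto simp: is_clique_def)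
        then have "b + 2 \<le> card {z \<in> L' - {v}. (x', z) \<in> E}"
          using L'deg[of x'] drop_v[OF L'(2), of x'] h by auto
        moreover have "{z \<in> K - {v}. (y', z) \<in> E} = K - {v, y'}"
          using K'(3) h irrefl by (auto simp: is_clique_def irrefl_def)
        moreover have "card (K - {v, y'}) = c - 2"
          using h L(1) K'(1) finK by (subst card_Diff_subset) (auto simp: c_def)
        ultimately have "b + 2 \<le> card {z \<in> L' - {v}. (x', z) \<in> E}" "card {z \<in> K - {v}. (y', z) \<in> E} = c - 2"
          by simp_all
        then show "k - 1 \<le> card {z \<in> L' - {v}. (x', z) \<in> E} + card {z \<in> K - {v}. (y', z) \<in> E}"
          using b m c_low by linarith
      qed (use L(1) K' L' x y \<open>y \<noteq> v\<close> \<open>x \<noteq> v\<close> in auto)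
      then show ?thesis using y by simp
    qed
  qed
qed

section \<open>Extremal counterexamples\<close>

definition counterexample :: "nat \<Rightarrow> nat \<Rightarrow> 'a set \<Rightarrow> ('a \<times> 'a) set \<Rightarrow> 'a \<Rightarrow> 'a \<Rightarrow> bool" where
  "counterexample k s V E u v \<longleftrightarrow> simple_graph V E \<and> biconnected V E \<and> (u, v) \<in> E \<and> no_long_path k E u v \<and>
     (2 choose s) + block_sum (wt s) (k - 3) (card V - 2) < card (cliques s V E)"

text \<open>
  The weights 3, 2, 1 make a switch towards u, v or a profitable even if the vertex that loses its
  neighbours is a. The switch keeps the number of edges, while adding an edge increases it.
\<close>
definition potential :: "'a \<Rightarrow> 'a \<Rightarrow> 'a \<Rightarrow> ('a \<times> 'a) set \<Rightarrow> nat" where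
  "potential u v a E = card E + 3 * card (E `` {u}) + 2 * card (E `` {v}) + card (E `` {a})"

lemma counterexample_swap: "counterexample k s V E u v \<Longrightarrow> counterexample k s V E v u"
  unfolding counterexample_def using no_long_path_swap
  by (auto simp: simple_graph_def dest: symD)

text \<open>
  Otherwise the graph splits along the edge uw into two smaller graphs, which satisfy the bound, and
  superadditivity of the block sum yields the bound for the whole graph.
\<close>
lemma counterexample_conn_on:
  fixes E :: "('a \<times> 'a) set"
  assumes k: "4 \<le> k" and s: "2 \<le> s"
    and IH: "\<And>V' (E' :: ('a \<times> 'a) set) u' v'. card V' < card V \<Longrightarrow> \<not> counterexample k s V' E' u' v'"
    and ex: "counterexample k s V E u v" and uw: "(u, w) \<in> E"
  shows "conn_on (V - {u, w}) E"
proof (rule ccontr)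
  assume cut: "\<not> conn_on (V - {u, w}) E"
  have G: "simple_graph V E" "biconnected V E" "(u, v) \<in> E" "no_long_path k E u v"
    and big: "(2 choose s) + block_sum (wt s) (k - 3) (card V - 2) < card (cliques s V E)"
    using ex by (auto simp: counterexample_def)
  have fin: "finite V" and sym: "sym E" and ne: "u \<noteq> w" using G uw by (auto simp: simple_graph_def irrefl_def)
  obtain A B where AB: "A \<union> B = V" "A \<inter> B = {u, w}" "card A < card V" "card B < card V" "v \<in> B"
    and closed: "\<And>p q. (p, q) \<in> E \<Longrightarrow> p \<in> A - {u, w} \<Longrightarrow> q \<in> A"
    and bic: "biconnected A (E \<inter> A \<times> A)" "biconnected B (E \<inter> B \<times> B)"
    and short: "no_long_path k (E \<inter> A \<times> A) u w" "no_long_path k (E \<inter> B \<times> B) u v"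
    using edge_cut_split[OF G(1,2,3) uw cut G(4)] by metis
  have uwAB: "u \<in> A" "w \<in> A" "u \<in> B" using AB(2) by auto
  have "simple_graph A (E \<inter> A \<times> A)" "simple_graph B (E \<inter> B \<times> B)"
    using AB(1) by (auto intro: simple_graph_restrict[OF G(1)])
  then have "card (cliques s A E) \<le> (2 choose s) + block_sum (wt s) (k - 3) (card A - 2)"
    "card (cliques s B E) \<le> (2 choose s) + block_sum (wt s) (k - 3) (card B - 2)"
    using IH[OF AB(3), of "E \<inter> A \<times> A" u w] IH[OF AB(4), of "E \<inter> B \<times> B" u v] bic short uw G(3) uwAB AB(5)
    by (auto simp: counterexample_def cliques_restrict not_less)
  moreover have "card (cliques s V E) + (2 choose s) = card (cliques s A E) + card (cliques s B E)"
    by (rule card_cliques_glue[OF G(1) uw s AB(1,2) closed])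
  moreover have "block_sum (wt s) (k - 3) (card A - 2) + block_sum (wt s) (k - 3) (card B - 2)
      \<le> block_sum (wt s) (k - 3) (card V - 2)"
  proof -
    have fAB: "finite A" "finite B" using AB(1) fin by auto
    then have "card A + card B = card V + 2" using card_Un_Int[of A B] AB(1,2) ne by simp
    moreover have "2 \<le> card A" "2 \<le> card B"
    proof -
      have "{u, w} \<subseteq> A" "{u, w} \<subseteq> B" "card {u, w} = 2" using AB(2) ne by auto
      then show "2 \<le> card A" "2 \<le> card B" using card_mono fAB by metis+
    qed
    ultimately have "card V - 2 = card A - 2 + (card B - 2)" by simp
    then show ?thesis using k block_sum_superadditive[OF mono_wt, of "k - 3"] by simp
  qed
  ultimately show False using big by linarith
qed

lemma card_switch:
  assumes "simple_graph V E" "(x, w) \<in> E"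
  shows "card (switch E x w) = card E"
    and "card (switch E x w `` {x}) = card (E `` {x}) + card (private_nbrs E x w)"
    and "card (switch E x w `` {w}) + card (private_nbrs E x w) = card (E `` {w})"
    and "z \<notin> {x, w} \<Longrightarrow> card (switch E x w `` {z}) = card (E `` {z})"
proof -
  have E: "sym E" "irrefl E" "finite V" "E \<subseteq> V \<times> V" using assms by (auto simp: simple_graph_def)
  define M where "M = private_nbrs E x w"
  have ne: "x \<noteq> w" "w \<notin> M" "x \<notin> M" using assms E by (auto simp: irrefl_def M_def private_nbrs_def)
  have M: "m \<in> M \<Longrightarrow> (w, m) \<in> E \<and> (m, w) \<in> E \<and> (x, m) \<notin> E \<and> (m, x) \<notin> E" for m
    using E by (auto simp: M_def private_nbrs_def dest: symD)
  have finE: "finite E" using E finite_subset by blast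
  have finM: "finite M" using M E by (intro finite_subset[of M V]) auto
  define R where "R c = {c} \<times> M \<union> M \<times> {c}" for c
  have cardR: "card (R c) = 2 * card M" if "c \<notin> M" for c
  proof -
    have "({c} \<times> M) \<inter> (M \<times> {c}) = {}" using that by auto
    then show ?thesis unfolding R_def using finM by (simp add: card_Un_disjoint)
  qed
  have sw: "switch E x w = (E - R w) \<union> R x" by (simp add: switch_def R_def M_def)
  have R: "R w \<subseteq> E" "R x \<inter> E = {}" "finite (R x)" "finite (R w)" using M finM by (auto simp: R_def)
  have "card ((E - R w) \<union> R x) = card (E - R w) + card (R x)"
    using R finE by (intro card_Un_disjoint) auto
  also have "\<dots> = card E - card (R w) + card (R x)" using R by (simp add: card_Diff_subset)
  also have "\<dots> = card E" using cardR ne R card_mono[OF finE R(1)] by simp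
  finally show "card (switch E x w) = card E" by (simp add: sw)
  have fin: "finite (E `` {z})" for z using finE by (intro finite_Image) 
  have "switch E x w `` {x} = E `` {x} \<union> M" using ne by (auto simp: sw R_def)
  moreover have "E `` {x} \<inter> M = {}" using M by auto
  ultimately show "card (switch E x w `` {x}) = card (E `` {x}) + card (private_nbrs E x w)"
    using fin finM by (simp add: card_Un_disjoint M_def)
  have "E `` {w} = switch E x w `` {w} \<union> M" "switch E x w `` {w} \<inter> M = {}"
    using ne M by (auto simp: sw R_def)
  then show "card (switch E x w `` {w}) + card (private_nbrs E x w) = card (E `` {w})"
    using fin[of w] finM by (metis M_def card_Un_disjoint finite_Un)
  show "card (switch E x w `` {z}) = card (E `` {z})" if z: "z \<notin> {x, w}"
  proof (cases "z \<in> M")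
    case False
    then have "switch E x w `` {z} = E `` {z}" using z by (auto simp: sw R_def)
    then show ?thesis by simp
  next
    case True
    then have "switch E x w `` {z} = insert x (E `` {z} - {w})" using z by (auto simp: sw R_def)
    moreover have "x \<notin> E `` {z}" "w \<in> E `` {z}" using M[OF True] by auto
    ultimately show ?thesis using fin[of z] card.remove[of "E `` {z}" w] by simp
  qed
qed

lemma potential_switch:
  assumes G: "simple_graph V E" and xw: "(x, w) \<in> E" and "x \<in> {u, v, a}" "w \<notin> {u, v}"
    and "u \<noteq> v" "a \<noteq> u" "a \<noteq> v" and M: "private_nbrs E x w \<noteq> {}"
  shows "potential u v a E < potential u v a (switch E x w)"
proof -
  have "x \<noteq> w" using G xw by (auto simp: simple_graph_def irrefl_def)
  have "private_nbrs E x w \<subseteq> V" using G by (auto simp: private_nbrs_def simple_graph_def)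
  then have "0 < card (private_nbrs E x w)" using M G finite_subset by (auto simp: simple_graph_def card_gt_0_iff)
  moreover note card_switch[OF G xw]
  ultimately show ?thesis
    using assms(3-7) \<open>x \<noteq> w\<close> unfolding potential_def by (cases "a = w") auto
qed

lemma potential_mono:
  assumes "finite E'" "E \<subseteq> E'"
  shows "potential u v a E \<le> potential u v a E'"
proof -
  have "card (E `` {z}) \<le> card (E' `` {z})" for z
    using assms by (intro card_mono finite_Image) auto
  moreover have "card E \<le> card E'" using assms by (simp add: card_mono)
  ultimately show ?thesis unfolding potential_def by (meson add_mono mult_le_mono2)
qed

lemma potential_strict_mono:
  assumes "finite E'" "E \<subset> E'"
  shows "potential u v a E < potential u v a E'"
proof -
  have "card (E `` {z}) \<le> card (E' `` {z})" for z
    using assms by (intro card_mono finite_Image) auto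
  then have "3 * card (E `` {u}) + 2 * card (E `` {v}) + card (E `` {a}) \<le>
      3 * card (E' `` {u}) + 2 * card (E' `` {v}) + card (E' `` {a})"
    by (meson add_mono mult_le_mono2)
  moreover have "card E < card E'" using assms by (simp add: psubset_card_mono)
  ultimately show ?thesis unfolding potential_def by linarith
qed

lemma dominating_of_closed:
  assumes conn: "conn_on A E" and a: "a \<in> A"
    and closed: "\<And>w z. w \<in> A \<Longrightarrow> (a, w) \<in> E \<Longrightarrow> z \<in> A \<Longrightarrow> (w, z) \<in> E \<Longrightarrow> z \<noteq> a \<Longrightarrow> (a, z) \<in> E"
  shows "dominating A E a"
  unfolding dominating_def
proof (intro ballI)
  fix z assume "z \<in> A"
  then have "(a, z) \<in> (E \<inter> A \<times> A)\<^sup>*" using conn a by (simp add: conn_on_def)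
  then show "z \<noteq> a \<longrightarrow> (a, z) \<in> E"
  proof (induction rule: rtrancl_induct)
    case (step y z)
    then show ?case using closed[of y z] by (cases "y = a") auto
  qed simp
qed

text \<open>
  Without common neighbours of x and w, the switch leaves w with x as its only neighbour. After
  joining w to y, any path from x to y through w is just x, w, y.
\<close>
lemma no_long_path_switch_edge:
  assumes G: "simple_graph V E" and xw: "(x, w) \<in> E" and y: "w \<noteq> y" "x \<noteq> y"
    and short: "no_long_path k E x y" and k: "4 \<le> k"
    and common: "\<And>c. (x, c) \<in> E \<Longrightarrow> (w, c) \<notin> E"
  shows "no_long_path k (switch E x w \<union> {(w, y), (y, w)}) x y"
  unfolding no_long_path_def
proof (intro allI impI)
  have E: "sym E" "irrefl E" using G by (auto simp: simple_graph_def)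
  have ne: "w \<noteq> x" using E xw by (auto simp: irrefl_def)
  let ?E = "switch E x w \<union> {(w, y), (y, w)}"
  have w_nbrs: "c \<in> {x, y}" if "(c, w) \<in> ?E" for c
    using that switch_w'[OF E xw, of c] common[of c] ne E(1) by (auto dest: symD)
  have w_nbrs': "c \<in> {x, y}" if "(w, c) \<in> ?E" for c
    using that switch_w[OF E xw, of c] common[of c] ne by auto
  fix p assume p: "path_between ?E x p y"
  show "length p < k"
  proof (cases "w \<in> set p")
    case False
    then have "path_between (switch E x w) x p y" by (intro path_between_mono[OF p]) auto
    then obtain q where "path_between E x q y" "length p \<le> length q"
      using switch_path[OF E xw] ne y(1) by blast
    then show ?thesis using short by (fastforce simp: no_long_path_def)
  next
    case True
    then obtain as bs where split: "p = as @ w # bs" by (meson split_list)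
    have pp: "hd p = x" "last p = y" "distinct p" "successively (\<lambda>a b. (a, b) \<in> ?E) p"
      using p by (auto simp only: path_between_def)
    have nonempty: "as \<noteq> []" "bs \<noteq> []" using pp(1,2) split ne y by auto
    have "(last as, w) \<in> ?E" "(w, hd bs) \<in> ?E"
      using pp(4) nonempty by (simp_all only: split successively_append_iff successively_Cons) simp_all
    then have "last as \<in> {x, y}" "hd bs \<in> {x, y}" using w_nbrs w_nbrs' by blast+
    moreover have "hd as = x" "last bs = y" using pp(1,2) split nonempty by auto
    moreover have "last as \<in> set as" "hd bs \<in> set bs" "hd as \<in> set as" "last bs \<in> set bs"
      using nonempty by auto
    moreover have dis: "distinct as" "distinct bs" "set as \<inter> set bs = {}" using pp(3) split by auto
    ultimately have "last as = hd as" "last bs = hd bs" by (metis disjoint_iff insertE singletonD)+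
    then have "length as = 1" "length bs = 1"
      using dis nonempty by (metis distinct.simps(2) last_ConsR last_in_set length_0_conv length_Suc_conv list.exhaust_sel One_nat_def list.size(4) list.size(3) add_0)+
    then show ?thesis using split k by simp
  qed
qed

text \<open>
  A switch towards x from a neighbour w with private neighbours would give another counterexample
  of larger potential, so neighbourhoods of neighbours of x are nested in that of x. Since
  deleting y leaves a connected graph, x is dominating.
\<close>
lemma extremal_end_dominating:
  fixes E :: "('a \<times> 'a) set"
  assumes k: "4 \<le> k" and s: "2 \<le> s"
    and IH: "\<And>V' (E' :: ('a \<times> 'a) set) u' v'. card V' < card V \<Longrightarrow> \<not> counterexample k s V' E' u' v'"
    and ex: "counterexample k s V E u v"
    and extremal: "\<And>E'. counterexample k s V E' u v \<Longrightarrow> potential u v a E' \<le> potential u v a E"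
    and a: "a \<noteq> u" "a \<noteq> v"
    and xy: "(x, y) = (u, v) \<or> (x, y) = (v, u)"
  shows "dominating V E x"
proof -
  have ex_xy: "counterexample k s V E x y" using ex xy counterexample_swap[OF ex] by auto
  then have G: "simple_graph V E" and bic: "biconnected V E" and xyE: "(x, y) \<in> E"
    and short: "no_long_path k E x y"
    and big: "(2 choose s) + block_sum (wt s) (k - 3) (card V - 2) < card (cliques s V E)"
    by (auto simp: counterexample_def)
  have E: "sym E" "irrefl E" "finite V" "E \<subseteq> V \<times> V" using G by (auto simp: simple_graph_def)
  have V: "x \<in> V" "y \<in> V" "x \<noteq> y" using xyE E by (auto simp: irrefl_def)
  have nested: "private_nbrs E x w = {}" if xw: "(x, w) \<in> E" and wy: "w \<noteq> y" for w
  proof (rule ccontr)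
    assume M: "private_nbrs E x w \<noteq> {}"
    have w: "w \<in> V" "w \<noteq> x" using xw E by (auto simp: irrefl_def)
    have conn: "conn_on (V - {x, w}) E" by (rule counterexample_conn_on[OF k s IH ex_xy xw])
    have swV: "switch E x w \<subseteq> V \<times> V"
      using E V by (auto simp: switch_def private_nbrs_def)
    have pot: "potential u v a E < potential u v a (switch E x w)"
      using potential_switch[OF G xw _ _ _ a M] xy w wy V by auto
    have xyS: "(x, y) \<in> switch E x w"
      using xyE wy V by (subst switch_x[OF E(1,2) xw]) auto
    \<comment> \<open>Any 2-connected supergraph of the switched graph without a long path contradicts extremality.\<close>
  have no: False
      if E': "switch E x w \<subseteq> E'" "simple_graph V E'" "no_long_path k E' x y" "c \<in> V - {x, w}" "(w, c) \<in> E'" for E' c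
    proof -
      have "sym E'" and finE': "finite E'" using E'(2) finite_subset by (auto simp: simple_graph_def)
      then have "biconnected V E'"
        using switch_biconnected[OF E(1,2) xw bic E'(1) _ conn E'(4,5) V(1) w(1)] by blast
      moreover have "card (cliques s V E) \<le> card (cliques s V E')"
      proof -
        have "card (cliques s V E) \<le> card (cliques s V (switch E x w))"
          by (rule switch_cliques[OF E(1,2) xw E(3) V(1)])
        also have "\<dots> \<le> card (cliques s V E')"
          using E'(1) by (intro card_mono finite_cliques[OF E(3)]) (auto simp: cliques_def)
        finally show ?thesis .
      qed
      ultimately have "counterexample k s V E' x y"
        using E' xyS big by (auto simp: counterexample_def)
      then have "counterexample k s V E' u v" using xy counterexample_swap[of k s V E' x y] by auto
      then have "potential u v a E' \<le> potential u v a E" by (rule extremal)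
      moreover have "potential u v a (switch E x w) \<le> potential u v a E'"
        by (rule potential_mono[OF finE' E'(1)])
      ultimately show False using pot by simp
    qed
    show False
    proof (cases "\<exists>c. (x, c) \<in> E \<and> (w, c) \<in> E")
      case True
      then obtain c where c: "(x, c) \<in> E" "(w, c) \<in> E" by blast
      show False
      proof (rule no[of "switch E x w" c])
        show "simple_graph V (switch E x w)"
          using E swV switch_sym[OF E(1,2) xw] switch_irrefl[OF E(1,2) xw] by (simp add: simple_graph_def)
        show "no_long_path k (switch E x w) x y"
          using short switch_path[OF E(1,2) xw _ w(2) wy] unfolding no_long_path_def
          by (meson le_less_trans)
        show c': "c \<in> V - {x, w}" using c E by (auto simp: irrefl_def)
        show "(w, c) \<in> switch E x w" using c c' by (subst switch_w[OF E(1,2) xw]) auto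
      qed simp
    next
      case False
      show False
      proof (rule no[of "switch E x w \<union> {(w, y), (y, w)}" y])
        have "sym (switch E x w \<union> {(w, y), (y, w)})" "irrefl (switch E x w \<union> {(w, y), (y, w)})"
          using switch_sym[OF E(1,2) xw] switch_irrefl[OF E(1,2) xw] wy
          by (auto simp: sym_def irrefl_def)
        then show "simple_graph V (switch E x w \<union> {(w, y), (y, w)})"
          using E(3) swV w V by (auto simp: simple_graph_def)
        show "no_long_path k (switch E x w \<union> {(w, y), (y, w)}) x y"
          by (rule no_long_path_switch_edge[OF G xw wy V(3) short k]) (use False in blast)
      qed (use V wy in auto)
    qed
  qed
  have "conn_on (V - {y}) E" using bic V by (simp add: biconnected_def)
  then have "dominating (V - {y}) E x"
  proof (rule dominating_of_closed)
    fix w z assume "w \<in> V - {y}" "(x, w) \<in> E" "z \<in> V - {y}" "(w, z) \<in> E" "z \<noteq> x"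
    then show "(x, z) \<in> E" using nested[of w] by (auto simp: private_nbrs_def)
  qed (use V in auto)
  then show ?thesis using xyE by (auto simp: dominating_def)
qed

lemma biconnected_of_dominating_pair:
  assumes G: "sym E" and "3 \<le> card V" and uv: "u \<in> V" "v \<in> V" "u \<noteq> v"
    and dom: "dominating V E u" "dominating V E v"
  shows "biconnected V E"
proof -
  have "conn_on (V - {c}) E" for c
  proof -
    obtain d where d: "d \<in> {u, v}" "d \<noteq> c" using uv(3) by blast
    let ?R = "E \<inter> (V - {c}) \<times> (V - {c})"
    have "(z, d) \<in> ?R\<^sup>*" "(d, z) \<in> ?R\<^sup>*" if "z \<in> V - {c}" for z
    proof -
      have "z = d \<or> (d, z) \<in> ?R \<and> (z, d) \<in> ?R"
        using that d uv dom G by (auto simp: dominating_def dest: symD)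
      then show "(z, d) \<in> ?R\<^sup>*" "(d, z) \<in> ?R\<^sup>*" by blast+
    qed
    then show ?thesis unfolding conn_on_def by (meson rtrancl_trans)
  qed
  then show ?thesis using assms(2) by (simp add: biconnected_def)
qed

text \<open>
  Once u and v are dominating, they remain so under switches between the other vertices, and they
  guarantee 2-connectedness. The graph without u and v is connected because the ends of the
  prescribed edge do not form a cut in a minimal counterexample.
\<close>
lemma extremal_third_dominating:
  fixes E :: "('a \<times> 'a) set"
  assumes k: "4 \<le> k" and s: "2 \<le> s"
    and IH: "\<And>V' (E' :: ('a \<times> 'a) set) u' v'. card V' < card V \<Longrightarrow> \<not> counterexample k s V' E' u' v'"
    and ex: "counterexample k s V E u v"
    and extremal: "\<And>E'. counterexample k s V E' u v \<Longrightarrow> potential u v a E' \<le> potential u v a E"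
    and a: "a \<in> V" "a \<noteq> u" "a \<noteq> v"
    and dom: "dominating V E u" "dominating V E v"
  shows "dominating V E a"
proof -
  have G: "simple_graph V E" and bic: "biconnected V E" and uvE: "(u, v) \<in> E"
    and short: "no_long_path k E u v"
    and big: "(2 choose s) + block_sum (wt s) (k - 3) (card V - 2) < card (cliques s V E)"
    using ex by (auto simp: counterexample_def)
  have E: "sym E" "irrefl E" "finite V" "E \<subseteq> V \<times> V" using G by (auto simp: simple_graph_def)
  have V: "u \<in> V" "v \<in> V" "u \<noteq> v" using uvE E by (auto simp: irrefl_def)
  have nested: "private_nbrs E a w = {}" if aw: "(a, w) \<in> E" and w: "w \<notin> {u, v}" for w
  proof (rule ccontr)
    assume M: "private_nbrs E a w \<noteq> {}"
    define E' where "E' = switch E a w"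
    have wV: "w \<in> V" "w \<noteq> a" using aw E by (auto simp: irrefl_def)
    have sym': "sym E'" unfolding E'_def by (rule switch_sym[OF E(1,2) aw])
    have "E' \<subseteq> V \<times> V" using E a by (auto simp: E'_def switch_def private_nbrs_def)
    then have simple: "simple_graph V E'"
      using E sym' switch_irrefl[OF E(1,2) aw] by (simp add: simple_graph_def E'_def)
    have keep: "dominating V E' d" if d: "dominating V E d" "d \<in> {u, v}" for d
      unfolding dominating_def
    proof (intro ballI impI)
      fix z assume z: "z \<in> V" "z \<noteq> d"
      have dz: "(d, z) \<in> E" "(d, a) \<in> E" "(d, w) \<in> E"
        using d z a w wV by (auto simp: dominating_def)
      have "d \<noteq> a" "d \<noteq> w" using d(2) a w by auto
      then show "(d, z) \<in> E'"
        using dz switch_x'[OF E(1,2) aw, of d] switch_w'[OF E(1,2) aw, of d] switch_others[OF E(1,2) aw, of d z]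
        unfolding E'_def by (cases "z = a"; cases "z = w") auto
    qed
    have "biconnected V E'"
      using bic keep dom V by (intro biconnected_of_dominating_pair[OF sym', of V u v]) (auto simp: biconnected_def)
    moreover have "no_long_path k E' u v"
      unfolding no_long_path_def
    proof (intro allI impI)
      fix p assume "path_between E' u p v"
      then obtain q where "path_between E u q v" "length p \<le> length q"
        using switch_path[OF E(1,2) aw, of u p v] w unfolding E'_def by blast
      then show "length p < k" using short by (fastforce simp: no_long_path_def)
    qed
    moreover have "(u, v) \<in> E'" using keep[OF dom(1)] V by (auto simp: dominating_def)
    moreover have "card (cliques s V E) \<le> card (cliques s V E')"
      unfolding E'_def by (rule switch_cliques[OF E(1,2) aw E(3) a(1)])
    ultimately have "counterexample k s V E' u v" using simple big by (simp add: counterexample_def)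
    then have "potential u v a E' \<le> potential u v a E" by (rule extremal)
    moreover have "potential u v a E < potential u v a E'"
      unfolding E'_def using potential_switch[OF G aw _ w V(3) a(2,3) M] by blast
    ultimately show False by simp
  qed
  have "conn_on (V - {u, v}) E" by (rule counterexample_conn_on[OF k s IH ex uvE])
  then have "dominating (V - {u, v}) E a"
  proof (rule dominating_of_closed)
    fix w z assume "w \<in> V - {u, v}" "(a, w) \<in> E" "z \<in> V - {u, v}" "(w, z) \<in> E" "z \<noteq> a"
    then show "(a, z) \<in> E" using nested[of w] by (auto simp: private_nbrs_def)
  qed (use a in auto)
  moreover have "(a, u) \<in> E" "(a, v) \<in> E" using dom a E(1) by (auto simp: dominating_def dest: symD)
  ultimately show ?thesis by (auto simp: dominating_def)
qed

text \<open>
  Graphs with fewer than k vertices satisfy the bound trivially, as then all vertices fit into one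
  block.
\<close>
theorem no_counterexample:
  fixes E :: "('a \<times> 'a) set"
  assumes k: "4 \<le> k" and s: "2 \<le> s"
  shows "\<not> counterexample k s V E u v"
proof (induction "card V" arbitrary: V E u v rule: less_induct)
  case less
  show ?case
  proof
    assume "counterexample k s V E u v"
    note ex0 = this
    have IH: "\<not> counterexample k s V' E' u' v'" if "card V' < card V" for V' :: "'a set" and E' u' v'
      using less that by blast
    have fin: "finite V" and three: "3 \<le> card V"
      using ex0 by (auto simp: counterexample_def simple_graph_def biconnected_def)
    have "V - {u, v} \<noteq> {}"
    proof
      assume "V - {u, v} = {}"
      then have "card V \<le> card {u, v}" by (intro card_mono) auto
      then show False using three card_insert_le_m1[of 2 "{v}" u] by (cases "u = v") auto
    qed
    then obtain a where a: "a \<in> V" "a \<noteq> u" "a \<noteq> v" by blast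
    have "\<exists>F. counterexample k s V F u v \<and> (\<forall>E'. counterexample k s V E' u v \<longrightarrow> potential u v a E' \<le> potential u v a F)"
    proof -
      define b where "b = potential u v a (V \<times> V)"
      have "\<forall>E'. counterexample k s V E' u v \<longrightarrow> potential u v a E' < Suc b"
        unfolding b_def less_Suc_eq_le using fin
        by (auto simp: counterexample_def simple_graph_def intro!: potential_mono)
      then show ?thesis
        using ex_has_greatest_nat[of "\<lambda>F. counterexample k s V F u v" E "potential u v a" "Suc b"] ex0 by blast
    qed
    then obtain F where ex: "counterexample k s V F u v"
      and extremal: "\<And>E'. counterexample k s V E' u v \<Longrightarrow> potential u v a E' \<le> potential u v a F" by blast
    have G: "simple_graph V F" and bic: "biconnected V F" and uvF: "(u, v) \<in> F"
      and short: "no_long_path k F u v"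
      and big: "(2 choose s) + block_sum (wt s) (k - 3) (card V - 2) < card (cliques s V F)"
      using ex by (auto simp: counterexample_def)
    have F: "sym F" "irrefl F" "F \<subseteq> V \<times> V" using G by (auto simp: simple_graph_def)
    have V: "u \<in> V" "v \<in> V" "u \<noteq> v" using uvF F by (auto simp: irrefl_def)
    have dom_u: "dominating V F u"
      by (rule extremal_end_dominating[OF k s IH ex extremal a(2,3), of u v]) simp_all
    have dom_v: "dominating V F v"
      by (rule extremal_end_dominating[OF k s IH ex extremal a(2,3), of v u]) simp_all
    have dom_a: "dominating V F a"
      by (rule extremal_third_dominating[OF k s IH ex extremal a dom_u dom_v])
    have large: "k \<le> card V"
    proof (rule ccontr)
      assume "\<not> ?thesis"
      then have "card V - 2 \<le> k - 3" using k by simp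
      then have "(2 choose s) + block_sum (wt s) (k - 3) (card V - 2) = card V choose s"
        using sum_wt[OF s, of "card V - 2"] three by (simp add: block_sum_short le_add_diff_inverse2 del: add_2_eq_Suc')
      then show False using big card_cliques_le_choose[OF fin, of s F] by simp
    qed
    have "card (cliques s V F) \<le> (2 choose s) + block_sum (wt s) (k - 3) (card V - 2)"
    proof (rule saturated_dominated_bound[OF k s G V(1,2) a(1) V(3) a(2,3) dom_u dom_v dom_a short large])
      fix x y assume xy: "x \<in> V" "y \<in> V" "x \<noteq> y" "(x, y) \<notin> F"
      let ?F = "F \<union> {(x, y), (y, x)}"
      have "simple_graph V ?F" using fin F xy by (auto simp: simple_graph_def sym_def irrefl_def)
      moreover have "biconnected V ?F" using bic by (rule biconnected_mono) auto
      moreover have "card (cliques s V F) \<le> card (cliques s V ?F)"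
        by (intro card_mono finite_cliques[OF fin]) (auto simp: cliques_def)
      moreover have "potential u v a F < potential u v a ?F"
        using xy F(3) fin by (intro potential_strict_mono) (auto intro: finite_subset)
      ultimately have "\<not> no_long_path k ?F u v"
        using extremal[of ?F] uvF big by (force simp: counterexample_def)
      then show "\<exists>p. path_between ?F u p v \<and> k \<le> length p"
        by (auto simp: no_long_path_def not_less)
    qed
    then show False using big by simp
  qed
qed

section \<open>Transfer to the digraph representation\<close>

lemma simple_graph_of_pair_graph:
  assumes "pair_graph G"
  shows "simple_graph (pverts G) (parcs G)"
proof -
  interpret pair_graph G by fact
  show ?thesis
    using pair_finite_verts arc_fst_in_verts arc_snd_in_verts pair_no_loops pair_sym_arcs
    by (force simp: simple_graph_def irrefl_def symmetric_def)
qed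

lemma num_cliques_eq:
  assumes "pair_graph G"
  shows "num_cliques s G = card (cliques s (pverts G) (parcs G))"
proof -
  interpret pair_graph G by fact
  have "complete_digraph s (induce_subgraph (with_proj G) C) \<longleftrightarrow>
      card C = s \<and> (\<forall>x\<in>C. \<forall>y\<in>C. x \<noteq> y \<longrightarrow> (x, y) \<in> parcs G)" if C: "C \<subseteq> pverts G" for C
  proof -
    have eq: "induce_subgraph (with_proj G) C = with_proj \<lparr>pverts = C, parcs = parcs G \<inter> C \<times> C\<rparr>"
      by (auto simp: induce_subgraph_def with_proj_def)
    have "finite C" using C pair_finite_verts finite_subset by blast
    then show ?thesis
      unfolding eq complete_digraph_pair_def using pair_no_loops by fastforce
  qed
  then show ?thesis unfolding num_cliques_def cliques_def by (intro arg_cong[of _ _ card]) auto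
qed

lemma biconnected_of_vertex_connected:
  assumes "pair_graph G" "vertex_connected 2 G"
  shows "biconnected (pverts G) (parcs G)"
proof -
  interpret pair_graph G by fact
  have sym: "sym (parcs G)" using pair_sym_arcs by (simp add: symmetric_def)
  have "conn_on (pverts G - {c}) (parcs G)" if c: "c \<in> pverts G" for c
  proof -
    let ?A = "pverts G - {c}"
    let ?H = "mk_symmetric (induce_subgraph (with_proj G) ?A)"
    have "connected (induce_subgraph (with_proj G) ?A)"
      using assms(2) c unfolding vertex_connected_def by auto
    then have reach: "x \<rightarrow>\<^sup>*\<^bsub>with_proj ?H\<^esub> y" if "x \<in> ?A" "y \<in> ?A" for x y
      using that by (auto simp: connected_def strongly_connected_def mk_symmetric_def)
    have "parcs ?H \<subseteq> parcs G \<inter> ?A \<times> ?A"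
      using sym by (auto simp: mk_symmetric_def induce_subgraph_def dest: symD)
    then show ?thesis
      unfolding conn_on_def
    proof (intro ballI)
      fix x y assume "x \<in> ?A" "y \<in> ?A"
      then have "(x, y) \<in> rtrancl_on (pverts ?H) (parcs ?H)" using reach by (simp add: reachable_def)
      then have "(x, y) \<in> (parcs ?H)\<^sup>*" by (induction rule: rtrancl_on.induct) (auto intro: rtrancl_into_rtrancl)
      then show "(x, y) \<in> (parcs G \<inter> ?A \<times> ?A)\<^sup>*"
        using \<open>parcs ?H \<subseteq> parcs G \<inter> ?A \<times> ?A\<close> rtrancl_mono by blast
    qed
  qed
  then show ?thesis using assms(2) by (simp add: biconnected_def vertex_connected_def)
qed

fun arcs_of_path :: "'a list \<Rightarrow> ('a \<times> 'a) list" where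
  "arcs_of_path (x # y # p) = (x, y) # arcs_of_path (y # p)"
| "arcs_of_path p = []"

lemma arcs_of_path_walk:
  assumes "p \<noteq> []" "successively (\<lambda>x y. (x, y) \<in> E) p"
  shows "pcas (hd p) (arcs_of_path p) (last p)" "set (arcs_of_path p) \<subseteq> E"
    "pawalk_verts (hd p) (arcs_of_path p) = p" "length (arcs_of_path p) = length p - 1"
  using assms by (induction p rule: arcs_of_path.induct) auto

text \<open>
  The arc from v to u closes a path from u to v, so the cycle has as many arcs as the path has
  vertices.
\<close>
lemma cycle_of_path:
  assumes "pair_graph G" and uv: "(u, v) \<in> parcs G" and p: "path_between (parcs G) u p v" and "3 \<le> length p"
  shows "\<exists>c. undirected_cycle G c \<and> length c = length p \<and> (v, u) \<in> set c"
proof -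
  interpret pair_graph G by fact
  have vu: "(v, u) \<in> parcs G" using uv pair_sym_arcs by (auto simp: symmetric_def dest: symD)
  have pp: "p \<noteq> []" "hd p = u" "last p = v" "distinct p" "successively (\<lambda>x y. (x, y) \<in> parcs G) p"
    using p by (simp_all add: path_between_def)
  define c where "c = (v, u) # arcs_of_path p"
  note walk = arcs_of_path_walk[OF pp(1,5)]
  have "awalk v c v"
    using walk(1,2) vu pp in_arcsD1[OF vu] by (simp add: awalk_def c_def)
  moreover have "distinct (tl (pawalk_verts v c))"
    using walk(3) pp by (simp add: c_def)
  ultimately have "cycle c" unfolding cycle_def by (auto simp: c_def)
  moreover have "length c = length p" using walk(4) pp(1) by (cases p) (simp_all add: c_def)
  ultimately show ?thesis
    using assms(4) by (intro exI[of _ c]) (simp add: undirected_cycle_def c_def)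
qed

theorem corollary1p6:
  fixes G :: "'a pair_pre_digraph" and n k s :: nat
  assumes "3 \<le> n" and "4 \<le> k" and "2 \<le> s"
    and "pair_graph G" and "card (pverts G) = n"
    and "vertex_connected 2 G"
    and "num_cliques s G > g_bound s n k"
  shows "\<forall>(u, v) \<in> parcs G. \<exists>p. undirected_cycle G p \<and> k \<le> length p \<and>
           ((u, v) \<in> set p \<or> (v, u) \<in> set p)"
proof (intro ballI, clarify)
  fix u v assume uv: "(u, v) \<in> parcs G"
  have "(2 choose s) + block_sum (wt s) (k - 3) (card (pverts G) - 2) < card (cliques s (pverts G) (parcs G))"
    using assms(7) g_bound_eq_block_sum[OF assms(2,3), of n] num_cliques_eq[OF assms(4), of s] assms(5) by simp
  then have "\<not> no_long_path k (parcs G) u v"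
    using no_counterexample[OF assms(2,3), of "pverts G" "parcs G" u v] uv
      simple_graph_of_pair_graph[OF assms(4)] biconnected_of_vertex_connected[OF assms(4,6)]
    by (simp add: counterexample_def)
  then obtain p where p: "path_between (parcs G) u p v" "k \<le> length p"
    by (auto simp: no_long_path_def not_less)
  then show "\<exists>p. undirected_cycle G p \<and> k \<le> length p \<and> ((u, v) \<in> set p \<or> (v, u) \<in> set p)"
    using cycle_of_path[OF assms(4) uv p(1)] assms(2) by fastforce
qed

end
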